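(* Let $X(Q,P)=\{X_D(Q,P),X_S(Q,P)\}$ be a stochastic field, with $X_D=(X_{Q,D},X_{P,D})$ and $X_S=(X_{Q,S},X_{P,S})$. The Stratonovich stochastic differential equation $$dQ=X_{Q,D}(Q,P)\,dt+X_{Q,S}(Q,P)\circ dB_t,\qquad dP=X_{P,D}(Q,P)\,dt+X_{P,S}(Q,P)\circ dB_t$$ is a stochastic Hamiltonian equation if and only if the operator $$O_X(Q,P)=\begin{pmatrix} dQ-X_{Q,D}\,dt-X_{Q,S}\circ dB_t\\ dP-X_{P,D}\,dt-X_{P,S}\circ dB_t\end{pmatrix}$$ has a self-adjoint Fréchet derivative with respect to the $L^2$-Stratonovich symplectic scalar product $\langle\cdot,\cdot\rangle_{L^2,J,\mathrm{Strato}}$. Moreover, in this case, the Hamiltonian $\mathbf{H}=\{H_D,H_S\}$ is given by $$H_D(Q,P)=\int_0^1\left[P\cdot X_{Q,D}(\lambda Q,\lambda P)-Q\cdot X_{P,D}(\lambda Q,\lambda P)\right]d\lambda,$$ $$H_S(Q,P)=\int_0^1\left[P\cdot X_{Q,S}(\lambda Q,\lambda P)-Q\cdot X_{P,S}(\lambda Q,\lambda P)\right]d\lambda .$$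
   Context: $B$ is an $n$-dimensional Brownian motion on a probability space $(\Omega,\mathcal{F},P)$, $[a,b]$ is a time interval, and $\circ\,dB_t$ denotes the Stratonovich integral. Process spaces. $\mathcal{S}([a,b],\mathbb{R}^m)$ is the set of $m$-dimensional Stratonovich processes over $[a,b]$, i.e. processes with $dX(t)=\mu(t,X(t))\,dt+\sigma(t,X(t))\circ dB(t)$, where $\mu:\mathbb{R}^{m+1}\to\mathbb{R}^m$ and $\sigma:\mathbb{R}^{m+1}\to\mathbb{R}^{m\times n}$; this means that $X$ is the Itô process with diffusion $\sigma$ and drift $\mu+\tilde\mu$, where $\tilde\mu_i=\frac12\sum_{j=1}^n\sum_{k=1}^m\frac{\partial\sigma_{ij}}{\partial x_k}\sigma_{kj}$. $\mathcal{S}^*([a,b],\mathbb{R}^m)$ is the set of these processes in differential form, $x=dX(t)$. $\mathcal{S}_0([a,b],\mathbb{R}^m)$ is the set of $X\in\mathcal{S}([a,b],\mathbb{R}^m)$ with $X(a,\omega)=X(b,\omega)=0$ for all $\omega$. Stochastic field. It is the data $\{X_D,X_S\}$ of the deterministic part (coefficient of $dt$) and the purely stochastic part (coefficient of $\circ\,dB_t$). Here $X_{Q,D},X_{P,D}$ take values in $\mathbb{R}^d$ and $X_{Q,S},X_{P,S}$ take values in $\mathbb{R}^{d\times n}$, as functions of $(Q,P)\in\mathbb{R}^d\times\mathbb{R}^d$. Stochastic Hamiltonian equation. The equation is stochastic Hamiltonian if one can find $\mathbf{H}=\{H_D,H_S\}$ with $H_D:\mathbb{R}^{2d}\to\mathbb{R}$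 and $H_S:\mathbb{R}^{2d}\to\mathbb{R}^n$ such that it reads $dQ=\frac{\partial H_D}{\partial P}dt+\frac{\partial H_S}{\partial P}\circ dB_t$, $dP=-\frac{\partial H_D}{\partial Q}dt-\frac{\partial H_S}{\partial Q}\circ dB_t$. Here $\frac{\partial H_S}{\partial P}$ is the $d\times n$ matrix with entries $\frac{\partial (H_S)_j}{\partial P_i}$, and similarly for $Q$. For $P\in\mathbb{R}^d$ and $M\in\mathbb{R}^{d\times n}$, $P\cdot M\in\mathbb{R}^n$ has entries $\sum_i P_iM_{ij}$. Fréchet derivative. For $U,V\in\mathcal{S}_0([a,b],\mathbb{R}^d)$, the Fréchet derivative of $O_X$ at $(Q,P)$ is $$DO_X(Q,P)(U,V)=\begin{pmatrix} dU-\left[\frac{\partial X_{Q,D}}{\partial Q}\cdot U+\frac{\partial X_{Q,D}}{\partial P}\cdot V\right]dt-\left[\frac{\partial X_{Q,S}}{\partial Q}\cdot U+\frac{\partial X_{Q,S}}{\partial P}\cdot V\right]\circ dB_t\\ dV-\left[\frac{\partial X_{P,D}}{\partial Q}\cdot U+\frac{\partial X_{P,D}}{\partial P}\cdot V\right]dt-\left[\frac{\partial X_{P,S}}{\partial Q}\cdot U+\frac{\partial X_{P,S}}{\partial P}\cdot V\right]\circ dB_t\end{pmatrix},$$ where for instance $\left(\frac{\partial X_{Q,S}}{\partial Q}\cdot U\right)_{ij}=\sum_k\frac{\partial (X_{Q,S})_{ij}}{\partial Q_k}U_k$. Symplectic scalar product. With $J=\begin{pmatrix}0&I_d\\-I_d&0\end{pmatrix}$,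 set $\langle X_t,dY_t\rangle_{L^2,\mathrm{Strato}}=\int_a^b X_t\circ dY_t$ and $\langle X_t,dY_t\rangle_{L^2,J,\mathrm{Strato}}=\langle X_t,J\cdot dY_t\rangle_{L^2,\mathrm{Strato}}$ for $X_t,Y_t\in\mathcal{S}([a,b],\mathbb{R}^{2d})$; with the differential in the first slot, $\langle dZ_t,Y_t\rangle_{L^2,J,\mathrm{Strato}}=\int_a^b (JY_t)\circ dZ_t$. Adjoint and self-adjointness. For $A:\mathcal{S}([a,b],\mathbb{R}^{2d})\to\mathcal{S}^*([a,b],\mathbb{R}^{2d})$, the adjoint $A_J^*:\mathcal{S}([a,b],\mathbb{R}^{2d})\to\mathcal{S}^*([a,b],\mathbb{R}^{2d})$ is defined by $\langle A\cdot X_t,Y_t\rangle_{L^2,J,\mathrm{Strato}}=\langle A_J^*\cdot Y_t,X_t\rangle_{L^2,J,\mathrm{Strato}}$, and $A$ is self-adjoint if $A=A_J^*$. For the Fréchet derivative, whose argument $(U,V)$ vanishes at the endpoints, the defining relation is $\langle DO_X(Q,P)(U,V),(F,G)\rangle_{L^2,J,\mathrm{Strato}}=\langle DO_J^*(Q,P)(F,G),(U,V)\rangle_{L^2,J,\mathrm{Strato}}$ with $U,V\in\mathcal{S}_0([a,b],\mathbb{R}^d)$ and $F,G\in\mathcal{S}([a,b],\mathbb{R}^d)$. *)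

theory Defs
  imports "HOL-Probability.Probability"
begin

section \<open>Partial derivatives\<close>

definition dirderiv :: "('a::real_normed_vector \<Rightarrow> 'b::real_normed_vector) \<Rightarrow> 'a \<Rightarrow> 'a \<Rightarrow> 'b" where
  "dirderiv f v x = vector_derivative (\<lambda>h. f (x + h *\<^sub>R v)) (at 0)"

definition C1_map :: "('a::euclidean_space \<Rightarrow> 'b::real_normed_vector) \<Rightarrow> bool" where
  "C1_map f \<longleftrightarrow> f differentiable_on UNIV \<and> (\<forall>k\<in>Basis. continuous_on UNIV (dirderiv f k))"


section \<open>Brownian motion with respect to a filtration\<close>

text \<open>The case of a Brownian motion without a prescribed filtration is that of its natural
  filtration.\<close>

definition brownian_motion ::
    "'w measure \<Rightarrow> (real \<Rightarrow> 'w measure) \<Rightarrow> (real \<Rightarrow> 'w \<Rightarrow> real^'n) \<Rightarrow> bool" where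
  "brownian_motion M F B \<longleftrightarrow>
     prob_space M \<and>
     filtration (space M) F \<and> (\<forall>t. sets (F t) \<subseteq> sets M) \<and>
     (\<forall>t\<ge>0. B t \<in> borel_measurable (F t)) \<and>
     (AE \<omega> in M. B 0 \<omega> = 0) \<and>
     (AE \<omega> in M. continuous_on {0..} (\<lambda>t. B t \<omega>)) \<and>
     (\<forall>s t. 0 \<le> s \<and> s < t \<longrightarrow>
        prob_space.indep_set M (sets (F s))
          {(\<lambda>\<omega>. B t \<omega> - B s \<omega>) -` A \<inter> space M | A. A \<in> sets borel} \<and>
        prob_space.indep_vars M (\<lambda>_. borel) (\<lambda>j \<omega>. B t \<omega> $ j - B s \<omega> $ j) UNIV \<and>
        (\<forall>j. distributed M lborel (\<lambda>\<omega>. B t \<omega> $ j - B s \<omega> $ j)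
               (normal_density 0 (sqrt (t - s)))))"


section \<open>Stochastic integrals as limits in probability\<close>

definition interval_partition :: "real \<Rightarrow> real \<Rightarrow> nat \<Rightarrow> (nat \<Rightarrow> real) \<Rightarrow> bool" where
  "interval_partition s t N \<tau> \<longleftrightarrow> \<tau> 0 = s \<and> \<tau> N = t \<and> (\<forall>i<N. \<tau> i < \<tau> (Suc i))"

text \<open>Convergence in probability, as the mesh of the partition tends to \<open>0\<close>. Measurability of
  the sums is demanded because the measure of a non-measurable set is \<open>0\<close> by convention.\<close>

definition tendsto_in_prob_mesh ::
    "'w measure \<Rightarrow> real \<Rightarrow> real \<Rightarrow> (nat \<Rightarrow> (nat \<Rightarrow> real) \<Rightarrow> 'w \<Rightarrow> 'b::euclidean_space)
      \<Rightarrow> ('w \<Rightarrow> 'b) \<Rightarrow> bool" where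
  "tendsto_in_prob_mesh M s t S I \<longleftrightarrow>
     I \<in> borel_measurable M \<and>
     (\<forall>N \<tau>. interval_partition s t N \<tau> \<longrightarrow> S N \<tau> \<in> borel_measurable M) \<and>
     (\<forall>\<epsilon>>0. \<exists>\<delta>>0. \<forall>N \<tau>.
        interval_partition s t N \<tau> \<and> (\<forall>i<N. \<tau> (Suc i) - \<tau> i < \<delta>) \<longrightarrow>
        measure M {\<omega> \<in> space M. \<epsilon> < norm (S N \<tau> \<omega> - I \<omega>)} < \<epsilon>)"

text \<open>A matrix-valued integrand with \<open>n\<close> columns in \<open>'a\<close> is represented by the vector
  \<open>G\<close> of its columns. For continuous adapted integrands, the only ones used below, the
  left-point sums converge to the Ito integral.\<close>

definition has_ito_integral ::
    "'w measure \<Rightarrow> (real \<Rightarrow> 'w \<Rightarrow> real^'n) \<Rightarrow> real \<Rightarrow> real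
      \<Rightarrow> (real \<Rightarrow> 'w \<Rightarrow> 'a::euclidean_space^'n) \<Rightarrow> ('w \<Rightarrow> 'a) \<Rightarrow> bool" where
  "has_ito_integral M B s t G I \<longleftrightarrow>
     tendsto_in_prob_mesh M s t
       (\<lambda>N \<tau> \<omega>. \<Sum>i<N. \<Sum>j\<in>UNIV. (B (\<tau> (Suc i)) \<omega> $ j - B (\<tau> i) \<omega> $ j) *\<^sub>R (G (\<tau> i) \<omega> $ j)) I"

text \<open>\<open>I\<close> is a version of the integral of \<open>Y \<circ> dZ\<close> over \<open>[s,t]\<close>.\<close>

definition has_strat_integral ::
    "'w measure \<Rightarrow> real \<Rightarrow> real
      \<Rightarrow> (real \<Rightarrow> 'w \<Rightarrow> 'a::euclidean_space) \<Rightarrow> (real \<Rightarrow> 'w \<Rightarrow> 'a) \<Rightarrow> ('w \<Rightarrow> real) \<Rightarrow> bool" where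
  "has_strat_integral M s t Y Z I \<longleftrightarrow>
     tendsto_in_prob_mesh M s t
       (\<lambda>N \<tau> \<omega>. \<Sum>i<N. ((Y (\<tau> i) \<omega> + Y (\<tau> (Suc i)) \<omega>) /\<^sub>R 2)
                         \<bullet> (Z (\<tau> (Suc i)) \<omega> - Z (\<tau> i) \<omega>)) I"


section \<open>Stratonovich processes\<close>

definition strat_correction ::
    "(real \<Rightarrow> 'a::euclidean_space \<Rightarrow> 'a^'n) \<Rightarrow> real \<Rightarrow> 'a \<Rightarrow> 'a" where
  "strat_correction \<sigma> t x =
     (1/2) *\<^sub>R (\<Sum>j\<in>UNIV. \<Sum>k\<in>Basis. (\<sigma> t x $ j \<bullet> k) *\<^sub>R dirderiv (\<lambda>y. \<sigma> t y $ j) k x)"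

text \<open>Solutions of \<open>dX = \<mu>(t,X) dt + \<sigma>(t,X) \<circ> dB\<close>, with \<open>\<sigma>\<close> of class \<open>C\<^sup>1\<close> in the space
  variable and \<open>\<mu>\<close> arbitrary subject to the integrability needed for an Ito process.\<close>

definition strat_process ::
    "'w measure \<Rightarrow> (real \<Rightarrow> 'w measure) \<Rightarrow> (real \<Rightarrow> 'w \<Rightarrow> real^'n) \<Rightarrow> real \<Rightarrow> real
      \<Rightarrow> (real \<Rightarrow> 'w \<Rightarrow> 'a::euclidean_space) set" where
  "strat_process M F B a b = {X.
     (\<forall>t\<in>{a..b}. X t \<in> borel_measurable (F t)) \<and>
     (AE \<omega> in M. continuous_on {a..b} (\<lambda>t. X t \<omega>)) \<and>
     (\<exists>(\<mu> :: real \<Rightarrow> 'a \<Rightarrow> 'a) (\<sigma> :: real \<Rightarrow> 'a \<Rightarrow> 'a^'n).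
        continuous_on UNIV (\<lambda>(t, x). \<sigma> t x) \<and>
        (\<forall>t. \<sigma> t differentiable_on UNIV) \<and>
        (\<forall>k\<in>Basis. continuous_on UNIV (\<lambda>(t, x). dirderiv (\<sigma> t) k x)) \<and>
        (AE \<omega> in M. set_integrable lborel {a..b}
                       (\<lambda>s. \<mu> s (X s \<omega>) + strat_correction \<sigma> s (X s \<omega>))) \<and>
        (\<forall>t\<in>{a..b}. \<exists>I. has_ito_integral M B a t (\<lambda>s \<omega>. \<sigma> s (X s \<omega>)) I \<and>
           (AE \<omega> in M. X t \<omega> = X a \<omega>
              + (LINT s:{a..t}|lborel. \<mu> s (X s \<omega>) + strat_correction \<sigma> s (X s \<omega>)) + I \<omega>)))}"

definition strat_process_0 ::
    "'w measure \<Rightarrow> (real \<Rightarrow> 'w measure) \<Rightarrow> (real \<Rightarrow> 'w \<Rightarrow> real^'n) \<Rightarrow> real \<Rightarrow> real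
      \<Rightarrow> (real \<Rightarrow> 'w \<Rightarrow> 'a::euclidean_space) set" where
  "strat_process_0 M F B a b =
     {X \<in> strat_process M F B a b. \<forall>\<omega>\<in>space M. X a \<omega> = 0 \<and> X b \<omega> = 0}"


section \<open>Stochastic differentials and the symplectic pairing\<close>

text \<open>\<open>SDiff X \<alpha> \<beta>\<close> is the stochastic differential \<open>dX + \<alpha> dt + \<beta> \<circ> dB\<close>, where \<open>X\<close>, \<open>\<alpha>\<close>, \<open>\<beta>\<close> are
  processes; \<open>SDiff X 0 0\<close> is \<open>dX\<close>, and \<open>\<beta>\<close> is given by its columns.\<close>

datatype ('w, 'a, 'n) sdiff =
  SDiff (sd_process: "real \<Rightarrow> 'w \<Rightarrow> 'a")
        (sd_drift: "real \<Rightarrow> 'w \<Rightarrow> 'a")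
        (sd_noise: "real \<Rightarrow> 'w \<Rightarrow> ('a, 'n) vec")

text \<open>\<open>I\<close> is a version of the integral of \<open>Y \<circ> (dX + \<alpha> dt + \<beta> \<circ> dB)\<close> over \<open>[a,b]\<close>, that is of
  \<open>Y \<circ> dX + Y \<cdot> \<alpha> dt + (Y \<cdot> \<beta>) \<circ> dB\<close>.\<close>

definition has_strat_pairing ::
    "'w measure \<Rightarrow> (real \<Rightarrow> 'w \<Rightarrow> real^'n) \<Rightarrow> real \<Rightarrow> real
      \<Rightarrow> (real \<Rightarrow> 'w \<Rightarrow> 'a::euclidean_space) \<Rightarrow> ('w, 'a, 'n) sdiff \<Rightarrow> ('w \<Rightarrow> real) \<Rightarrow> bool" where
  "has_strat_pairing M B a b Y z I \<longleftrightarrow>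
     (\<exists>I\<^sub>X I\<^sub>B.
        has_strat_integral M a b Y (sd_process z) I\<^sub>X \<and>
        has_strat_integral M a b (\<lambda>t \<omega>. \<chi> j. Y t \<omega> \<bullet> (sd_noise z t \<omega> $ j)) B I\<^sub>B \<and>
        (AE \<omega> in M. set_integrable lborel {a..b} (\<lambda>t. Y t \<omega> \<bullet> sd_drift z t \<omega>)) \<and>
        (AE \<omega> in M. I \<omega> = I\<^sub>X \<omega> + (LINT t:{a..b}|lborel. Y t \<omega> \<bullet> sd_drift z t \<omega>) + I\<^sub>B \<omega>))"

definition symp_J :: "'a \<times> 'a \<Rightarrow> 'a \<times> 'a::ab_group_add" where
  "symp_J = (\<lambda>(u, v). (v, - u))"

text \<open>\<open>I\<close> is a version of \<open>\<langle>z, Y\<rangle>\<close> for the symplectic pairing, the differential \<open>z\<close> being in the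
  first slot.\<close>

definition has_J_pairing ::
    "'w measure \<Rightarrow> (real \<Rightarrow> 'w \<Rightarrow> real^'n) \<Rightarrow> real \<Rightarrow> real
      \<Rightarrow> ('w, 'a::euclidean_space \<times> 'a, 'n) sdiff \<Rightarrow> (real \<Rightarrow> 'w \<Rightarrow> 'a \<times> 'a) \<Rightarrow> ('w \<Rightarrow> real) \<Rightarrow> bool"
  where
  "has_J_pairing M B a b z Y I \<longleftrightarrow> has_strat_pairing M B a b (\<lambda>t \<omega>. symp_J (Y t \<omega>)) z I"

definition pair_process :: "(real \<Rightarrow> 'w \<Rightarrow> 'a) \<Rightarrow> (real \<Rightarrow> 'w \<Rightarrow> 'a) \<Rightarrow> real \<Rightarrow> 'w \<Rightarrow> 'a \<times> 'a" where
  "pair_process U V t \<omega> = (U t \<omega>, V t \<omega>)"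

text \<open>\<open>A'\<close> satisfies the relation \<open>\<langle>A (U,V), (F,G)\<rangle> = \<langle>A' (F,G), (U,V)\<rangle>\<close> defining the adjoint of
  \<open>A\<close>. Pairings being random variables known up to null sets, equality means that both sides have
  the same versions; in particular one side exists if and only if the other one does.\<close>

definition is_J_adjoint ::
    "'w measure \<Rightarrow> (real \<Rightarrow> 'w measure) \<Rightarrow> (real \<Rightarrow> 'w \<Rightarrow> real^'n) \<Rightarrow> real \<Rightarrow> real
      \<Rightarrow> ((real \<Rightarrow> 'w \<Rightarrow> 'a::euclidean_space \<times> 'a) \<Rightarrow> ('w, 'a \<times> 'a, 'n) sdiff)
      \<Rightarrow> ((real \<Rightarrow> 'w \<Rightarrow> 'a \<times> 'a) \<Rightarrow> ('w, 'a \<times> 'a, 'n) sdiff) \<Rightarrow> bool" where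
  "is_J_adjoint M \<F> B a b A A' \<longleftrightarrow>
     (\<forall>U \<in> strat_process_0 M \<F> B a b. \<forall>V \<in> strat_process_0 M \<F> B a b.
      \<forall>F \<in> strat_process M \<F> B a b. \<forall>G \<in> strat_process M \<F> B a b.
      \<forall>I. has_J_pairing M B a b (A (pair_process U V)) (pair_process F G) I \<longleftrightarrow>
          has_J_pairing M B a b (A' (pair_process F G)) (pair_process U V) I)"

definition J_self_adjoint ::
    "'w measure \<Rightarrow> (real \<Rightarrow> 'w measure) \<Rightarrow> (real \<Rightarrow> 'w \<Rightarrow> real^'n) \<Rightarrow> real \<Rightarrow> real
      \<Rightarrow> ((real \<Rightarrow> 'w \<Rightarrow> 'a::euclidean_space \<times> 'a) \<Rightarrow> ('w, 'a \<times> 'a, 'n) sdiff) \<Rightarrow> bool" where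
  "J_self_adjoint M F B a b A \<longleftrightarrow> is_J_adjoint M F B a b A A"


section \<open>Stochastic fields, their operators and Hamiltonians\<close>

type_synonym 'd phase = "(real^'d) \<times> (real^'d)"

record ('d::finite, 'n::finite) stoch_field =
  XQD :: "'d phase \<Rightarrow> real^'d"
  XPD :: "'d phase \<Rightarrow> real^'d"
  XQS :: "'d phase \<Rightarrow> real^'n^'d"
  XPS :: "'d phase \<Rightarrow> real^'n^'d"

definition C1_field :: "('d::finite, 'n::finite) stoch_field \<Rightarrow> bool" where
  "C1_field X \<longleftrightarrow> C1_map (XQD X) \<and> C1_map (XPD X) \<and> C1_map (XQS X) \<and> C1_map (XPS X)"

text \<open>The differential \<open>dR - (x\<^sub>Q, x\<^sub>P) dt - (m\<^sub>Q, m\<^sub>P) \<circ> dB\<close>.\<close>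

definition field_sdiff ::
    "(real \<Rightarrow> 'w \<Rightarrow> 'd phase)
      \<Rightarrow> (real \<Rightarrow> 'w \<Rightarrow> real^'d) \<Rightarrow> (real \<Rightarrow> 'w \<Rightarrow> real^'d)
      \<Rightarrow> (real \<Rightarrow> 'w \<Rightarrow> real^'n^'d) \<Rightarrow> (real \<Rightarrow> 'w \<Rightarrow> real^'n^'d)
      \<Rightarrow> ('w, 'd phase, 'n) sdiff" where
  "field_sdiff R x\<^sub>Q x\<^sub>P m\<^sub>Q m\<^sub>P =
     SDiff R (\<lambda>t \<omega>. - (x\<^sub>Q t \<omega>, x\<^sub>P t \<omega>))
             (\<lambda>t \<omega>. \<chi> j. - (column j (m\<^sub>Q t \<omega>), column j (m\<^sub>P t \<omega>)))"

definition field_op ::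
    "('d::finite, 'n::finite) stoch_field \<Rightarrow> (real \<Rightarrow> 'w \<Rightarrow> 'd phase)
      \<Rightarrow> ('w, 'd phase, 'n) sdiff" where
  "field_op X R =
     field_sdiff R (\<lambda>t \<omega>. XQD X (R t \<omega>)) (\<lambda>t \<omega>. XPD X (R t \<omega>))
                   (\<lambda>t \<omega>. XQS X (R t \<omega>)) (\<lambda>t \<omega>. XPS X (R t \<omega>))"

text \<open>\<open>\<partial>f/\<partial>Q \<cdot> u + \<partial>f/\<partial>P \<cdot> v\<close> at the point \<open>z\<close>.\<close>

definition phase_deriv ::
    "('d::finite phase \<Rightarrow> 'b::real_normed_vector) \<Rightarrow> 'd phase \<Rightarrow> 'd phase \<Rightarrow> 'b"
  where
  "phase_deriv f z = (\<lambda>(u, v).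
     (\<Sum>k\<in>UNIV. (u $ k) *\<^sub>R dirderiv f (axis k 1, 0) z)
     + (\<Sum>k\<in>UNIV. (v $ k) *\<^sub>R dirderiv f (0, axis k 1) z))"

text \<open>The Frechet derivative of \<^term>\<open>field_op X\<close> at \<open>R = (Q,P)\<close>, applied to \<open>W = (U,V)\<close>.\<close>

definition D_field_op ::
    "('d::finite, 'n::finite) stoch_field \<Rightarrow> (real \<Rightarrow> 'w \<Rightarrow> 'd phase)
      \<Rightarrow> (real \<Rightarrow> 'w \<Rightarrow> 'd phase) \<Rightarrow> ('w, 'd phase, 'n) sdiff" where
  "D_field_op X R W =
     field_sdiff W (\<lambda>t \<omega>. phase_deriv (XQD X) (R t \<omega>) (W t \<omega>))
                   (\<lambda>t \<omega>. phase_deriv (XPD X) (R t \<omega>) (W t \<omega>))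
                   (\<lambda>t \<omega>. phase_deriv (XQS X) (R t \<omega>) (W t \<omega>))
                   (\<lambda>t \<omega>. phase_deriv (XPS X) (R t \<omega>) (W t \<omega>))"

definition is_hamiltonian ::
    "('d::finite, 'n::finite) stoch_field
      \<Rightarrow> ('d phase \<Rightarrow> real) \<Rightarrow> ('d phase \<Rightarrow> real^'n) \<Rightarrow> bool" where
  "is_hamiltonian X H\<^sub>D H\<^sub>S \<longleftrightarrow> (\<forall>z i.
     ((\<lambda>h. H\<^sub>D (z + h *\<^sub>R (0, axis i 1))) has_real_derivative XQD X z $ i) (at 0) \<and>
     ((\<lambda>h. H\<^sub>D (z + h *\<^sub>R (axis i 1, 0))) has_real_derivative - XPD X z $ i) (at 0) \<and>
     (\<forall>j. ((\<lambda>h. H\<^sub>S (z + h *\<^sub>R (0, axis i 1)) $ j) has_real_derivative XQS X z $ i $ j) (at 0) \<and>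
          ((\<lambda>h. H\<^sub>S (z + h *\<^sub>R (axis i 1, 0)) $ j) has_real_derivative - XPS X z $ i $ j) (at 0)))"

definition stoch_hamiltonian :: "('d::finite, 'n::finite) stoch_field \<Rightarrow> bool" where
  "stoch_hamiltonian X \<longleftrightarrow> (\<exists>H\<^sub>D H\<^sub>S. is_hamiltonian X H\<^sub>D H\<^sub>S)"

definition ham_D :: "('d::finite, 'n::finite) stoch_field \<Rightarrow> 'd phase \<Rightarrow> real" where
  "ham_D X = (\<lambda>(q, p). integral {0..1} (\<lambda>l.
     p \<bullet> XQD X (l *\<^sub>R q, l *\<^sub>R p) - q \<bullet> XPD X (l *\<^sub>R q, l *\<^sub>R p)))"

definition ham_S :: "('d::finite, 'n::finite) stoch_field \<Rightarrow> 'd phase \<Rightarrow> real^'n" where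
  "ham_S X = (\<lambda>(q, p). integral {0..1} (\<lambda>l.
     p v* XQS X (l *\<^sub>R q, l *\<^sub>R p) - q v* XPS X (l *\<^sub>R q, l *\<^sub>R p)))"


text \<open>By this lemma the components of \<^term>\<open>D_field_op X R W\<close> are, at each time and sample point,
  the derivatives at \<open>h = 0\<close> of those of \<^term>\<open>field_op X (\<lambda>t \<omega>. R t \<omega> + h *\<^sub>R W t \<omega>)\<close>.\<close>

lemma phase_deriv_has_vector_derivative:
  fixes f :: "'d::finite phase \<Rightarrow> 'b::real_normed_vector"
  assumes "C1_map f"
  shows "((\<lambda>h. f (z + h *\<^sub>R w)) has_vector_derivative phase_deriv f z w) (at 0)"
proof -
  from assms have "f differentiable (at z)"
    unfolding C1_map_def differentiable_on_def by blast
  then obtain D where D: "(f has_derivative D) (at z)"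
    by (auto simp: differentiable_def)
  interpret D: bounded_linear D using D by (rule has_derivative_bounded_linear)
  have dir: "((\<lambda>h. f (z + h *\<^sub>R v)) has_vector_derivative D v) (at 0)" for v
  proof -
    have "((\<lambda>h. z + h *\<^sub>R v) has_derivative (\<lambda>h. h *\<^sub>R v)) (at 0)"
      by (auto intro!: derivative_eq_intros)
    moreover have "(f has_derivative D) (at (z + 0 *\<^sub>R v))" using D by simp
    ultimately have "((\<lambda>h. f (z + h *\<^sub>R v)) has_derivative (\<lambda>h. D (h *\<^sub>R v))) (at 0)"
      by (rule has_derivative_compose)
    then show ?thesis by (simp add: has_vector_derivative_def D.scaleR)
  qed
  have dd: "dirderiv f v z = D v" for v
    unfolding dirderiv_def using dir by (rule vector_derivative_at)
  obtain u v where w: "w = (u, v)" by (cases w)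
  have u: "(u, 0) = (\<Sum>k\<in>UNIV. u $ k *\<^sub>R (axis k 1, 0 :: real^'d))"
    by (subst basis_expansion[of u, symmetric])
       (simp add: prod_eq_iff fst_sum snd_sum scalar_mult_eq_scaleR)
  have v: "(0, v) = (\<Sum>k\<in>UNIV. v $ k *\<^sub>R (0 :: real^'d, axis k 1))"
    by (subst basis_expansion[of v, symmetric])
       (simp add: prod_eq_iff fst_sum snd_sum scalar_mult_eq_scaleR)
  have "D w = D (u, 0) + D (0, v)" by (simp add: w flip: D.add)
  also have "\<dots> = phase_deriv f z w"
    unfolding u v D.sum D.scaleR by (simp add: w phase_deriv_def dd)
  finally show ?thesis using dir[of w] by simp
qed

end

theory Submission
  imports Defs
begin

text \<open>Both conditions are equivalent to the symmetry of \<open>J\<^sup>T DX\<close>, for the drift and for each column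
  of the noise coefficient. For a Hamiltonian field this is Schwarz's theorem, and the Poincare
  lemma, with the stated integrals as potentials, gives the converse.

  If the derivative is symmetric, the \<open>dt\<close> and \<open>\<circ> dB\<close> terms of the two pairings agree pointwise, and
  summation by parts is exact for the midpoint sums of the remaining terms, since \<open>(U,V)\<close> vanishes
  at the endpoints.

  Conversely, take \<open>(Q,P)\<close> and \<open>(F,G)\<close> constant and \<open>(U,V) = \<phi> w\<close> with \<open>\<phi>\<close> deterministic.
  Self-adjointness then reads \<open>c \<integral> \<phi> dt = \<integral> \<phi>' (g \<cdot> B) dt\<close> almost surely, where \<open>c\<close> and \<open>g\<close> are the
  antisymmetric parts of drift and noise. Letting \<open>\<phi>\<close> tend to \<open>1\<close> inside the interval gives
  \<open>c (b - a) = - g \<cdot> (B b - B a)\<close>, and an increment of Brownian motion is nondegenerate.\<close>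

section \<open>Schwarz's theorem and the Poincare lemma\<close>

text \<open>The hypothesis concerns parameter 0 but every base point. Shifting the base point to
  \<open>z + t *\<^sub>R w\<close> gives the derivative at any \<open>t\<close>, as the mean value
  theorem and Leibniz's rule require.\<close>

lemma has_vector_derivative_along_line:
  fixes f :: "'a::real_vector \<Rightarrow> 'b::real_normed_vector"
  assumes "\<And>z. ((\<lambda>h. f (z + h *\<^sub>R w)) has_vector_derivative f' z) (at 0)"
  shows "((\<lambda>h. f (z + h *\<^sub>R w)) has_vector_derivative f' (z + t *\<^sub>R w)) (at t)"
proof -
  have "((\<lambda>h. h - t) has_vector_derivative 1) (at t)"
    by (auto intro!: derivative_eq_intros simp: has_vector_derivative_def)
  moreover have "((\<lambda>h. f (z + t *\<^sub>R w + h *\<^sub>R w)) has_vector_derivative f' (z + t *\<^sub>R w))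
      (at (t - t))"
    using assms[of "z + t *\<^sub>R w"] by simp
  ultimately have "((\<lambda>h. f (z + t *\<^sub>R w + h *\<^sub>R w)) \<circ> (\<lambda>h. h - t)
      has_vector_derivative 1 *\<^sub>R f' (z + t *\<^sub>R w)) (at t)"
    by (rule vector_diff_chain_at)
  moreover have "(\<lambda>h. f (z + t *\<^sub>R w + h *\<^sub>R w)) \<circ> (\<lambda>h. h - t) = (\<lambda>h. f (z + h *\<^sub>R w))"
    by (simp add: fun_eq_iff scaleR_left_diff_distrib)
  ultimately show ?thesis by simp
qed

lemma has_real_derivative_along_line:
  fixes f :: "'a::real_normed_vector \<Rightarrow> real"
  assumes "\<And>z. ((\<lambda>h. f (z + h *\<^sub>R w)) has_real_derivative f' z) (at 0)"
  shows "((\<lambda>h. f (z + h *\<^sub>R w)) has_real_derivative f' (z + t *\<^sub>R w)) (at t)"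
  using has_vector_derivative_along_line[of f w f'] assms
  by (simp add: has_real_derivative_iff_has_vector_derivative)

text \<open>The mean value theorem is applied twice: along \<open>u\<close> to the increment of
  \<open>H\<close> in direction \<open>h *\<^sub>R v\<close>, which brings in \<open>p\<close>, and
  then along \<open>v\<close> to \<open>p\<close>.\<close>

lemma mixed_difference_mean_value:
  fixes H p r :: "'a::real_normed_vector \<Rightarrow> real"
  assumes H: "\<And>z. ((\<lambda>h. H (z + h *\<^sub>R u)) has_real_derivative p z) (at 0)"
    and p: "\<And>z. ((\<lambda>h. p (z + h *\<^sub>R v)) has_real_derivative r z) (at 0)"
    and "0 < h"
  obtains s t where "0 < s" "s < h" "0 < t" "t < h"
    "H (z + h *\<^sub>R u + h *\<^sub>R v) - H (z + h *\<^sub>R u) - H (z + h *\<^sub>R v) + H z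
      = h * h * r (z + s *\<^sub>R u + t *\<^sub>R v)"
proof -
  let ?g = "\<lambda>s. H (z + h *\<^sub>R v + s *\<^sub>R u) - H (z + s *\<^sub>R u)"
  have "DERIV ?g s :> p (z + h *\<^sub>R v + s *\<^sub>R u) - p (z + s *\<^sub>R u)" for s
    by (intro DERIV_diff has_real_derivative_along_line[where f = H and f' = p] H)
  from MVT2[OF \<open>0 < h\<close>, of ?g, OF this] obtain s where s: "0 < s" "s < h"
    "?g h - ?g 0 = (h - 0) * (p (z + h *\<^sub>R v + s *\<^sub>R u) - p (z + s *\<^sub>R u))"
    by auto
  let ?k = "\<lambda>t. p (z + s *\<^sub>R u + t *\<^sub>R v)"
  have "DERIV ?k t :> r (z + s *\<^sub>R u + t *\<^sub>R v)" for t
    by (intro has_real_derivative_along_line[where f = p and f' = r] p)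
  from MVT2[OF \<open>0 < h\<close>, of ?k, OF this] obtain t where t: "0 < t" "t < h"
    "?k h - ?k 0 = (h - 0) * r (z + s *\<^sub>R u + t *\<^sub>R v)"
    by auto
  show thesis
    by (rule that[OF s(1,2) t(1,2)]) (use s(3) t(3) in \<open>simp add: add_ac\<close>)
qed

text \<open>The second difference of \<open>H\<close> is symmetric in \<open>u\<close> and
  \<open>v\<close>. Its two mean value forms therefore equate a value of \<open>r\<close> with a
  value of \<open>s\<close> at points close to \<open>z\<close>, and continuity at \<open>z\<close>
  allows \<open>h\<close> to tend to 0.\<close>

lemma mixed_partial_derivatives_commute:
  fixes H p q r s :: "'a::real_normed_vector \<Rightarrow> real"
  assumes Hu: "\<And>z. ((\<lambda>h. H (z + h *\<^sub>R u)) has_real_derivative p z) (at 0)"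
    and Hv: "\<And>z. ((\<lambda>h. H (z + h *\<^sub>R v)) has_real_derivative q z) (at 0)"
    and p: "\<And>z. ((\<lambda>h. p (z + h *\<^sub>R v)) has_real_derivative r z) (at 0)"
    and q: "\<And>z. ((\<lambda>h. q (z + h *\<^sub>R u)) has_real_derivative s z) (at 0)"
    and cont: "isCont r z" "isCont s z"
  shows "r z = s z"
proof -
  have "\<exists>a b c d. 0 < a \<and> a < h \<and> 0 < b \<and> b < h \<and> 0 < c \<and> c < h \<and> 0 < d \<and> d < h \<and>
      r (z + a *\<^sub>R u + b *\<^sub>R v) = s (z + c *\<^sub>R v + d *\<^sub>R u)" if "0 < h" for h
  proof -
    obtain a b where 1: "0 < a" "a < h" "0 < b" "b < h"
      "H (z + h *\<^sub>R u + h *\<^sub>R v) - H (z + h *\<^sub>R u) - H (z + h *\<^sub>R v) + H z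
        = h * h * r (z + a *\<^sub>R u + b *\<^sub>R v)"
      by (rule mixed_difference_mean_value[OF Hu p \<open>0 < h\<close>])
    obtain c d where 2: "0 < c" "c < h" "0 < d" "d < h"
      "H (z + h *\<^sub>R v + h *\<^sub>R u) - H (z + h *\<^sub>R v) - H (z + h *\<^sub>R u) + H z
        = h * h * s (z + c *\<^sub>R v + d *\<^sub>R u)"
      by (rule mixed_difference_mean_value[OF Hv q \<open>0 < h\<close>])
    have "h * h * r (z + a *\<^sub>R u + b *\<^sub>R v) = h * h * s (z + c *\<^sub>R v + d *\<^sub>R u)"
      unfolding 1(5)[symmetric] 2(5)[symmetric] by (simp add: add_ac)
    with 1 2 \<open>0 < h\<close> show ?thesis by auto
  qed
  then obtain a b c d where abcd: "\<And>h. 0 < h \<Longrightarrow> 0 < a h \<and> a h < h \<and> 0 < b h \<and> b h < h \<and>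
      0 < c h \<and> c h < h \<and> 0 < d h \<and> d h < (h::real) \<and>
      r (z + a h *\<^sub>R u + b h *\<^sub>R v) = s (z + c h *\<^sub>R v + d h *\<^sub>R u)"
    by metis
  \<comment> \<open>All four intermediate parameters lie strictly between 0 and \<open>h\<close>, so
    they are squeezed to 0.\<close>
  have lim: "(f \<longlongrightarrow> 0) (at_right 0)" if "\<And>h. 0 < h \<Longrightarrow> 0 < f h \<and> f h < h" for f :: "real \<Rightarrow> real"
    by (rule tendsto_sandwich[where f = "\<lambda>_. 0" and h = "\<lambda>h. h"])
       (auto intro!: eventually_mono[OF eventually_at_right_less[of 0]] less_imp_le dest: that)
  have "((\<lambda>h. z + a h *\<^sub>R u + b h *\<^sub>R v) \<longlongrightarrow> z + 0 *\<^sub>R u + 0 *\<^sub>R v) (at_right 0)"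
    by (intro tendsto_intros lim) (use abcd in auto)
  then have 1: "((\<lambda>h. r (z + a h *\<^sub>R u + b h *\<^sub>R v)) \<longlongrightarrow> r z) (at_right 0)"
    using isCont_tendsto_compose[OF cont(1)] by simp
  have "((\<lambda>h. z + c h *\<^sub>R v + d h *\<^sub>R u) \<longlongrightarrow> z + 0 *\<^sub>R v + 0 *\<^sub>R u) (at_right 0)"
    by (intro tendsto_intros lim) (use abcd in auto)
  then have 2: "((\<lambda>h. s (z + c h *\<^sub>R v + d h *\<^sub>R u)) \<longlongrightarrow> s z) (at_right 0)"
    using isCont_tendsto_compose[OF cont(2)] by simp
  have "\<forall>\<^sub>F h in at_right 0. r (z + a h *\<^sub>R u + b h *\<^sub>R v) = s (z + c h *\<^sub>R v + d h *\<^sub>R u)"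
    using abcd by (auto simp: eventually_at_filter)
  with 1 have "((\<lambda>h. s (z + c h *\<^sub>R v + d h *\<^sub>R u)) \<longlongrightarrow> r z) (at_right 0)"
    by (simp cong: tendsto_cong)
  then show ?thesis using 2 by (intro tendsto_unique) auto
qed

text \<open>The potential is the integral of \<open>V\<close> along the ray from 0. After
  differentiation under the integral sign, symmetry of \<open>D\<close> makes the integrand an exact
  derivative in \<open>l\<close>, and the fundamental theorem of calculus leaves only the value at
  \<open>l = 1\<close>.\<close>

lemma poincare_potential:
  fixes V :: "'a::euclidean_space \<Rightarrow> 'a"
  assumes V: "\<And>z w. ((\<lambda>h. V (z + h *\<^sub>R w)) has_vector_derivative D z w) (at 0)"
    and contV: "continuous_on UNIV V"
    and contD: "\<And>w. continuous_on UNIV (\<lambda>z. D z w)"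
    and linD: "\<And>z. linear (D z)"
    and sym: "\<And>z w y. D z w \<bullet> y = w \<bullet> D z y"
  shows "((\<lambda>h. integral {0..1} (\<lambda>l. (z + h *\<^sub>R y) \<bullet> V (l *\<^sub>R (z + h *\<^sub>R y))))
            has_real_derivative V z \<bullet> y) (at 0)"
proof -
  let ?f = "\<lambda>h l. (z + h *\<^sub>R y) \<bullet> V (l *\<^sub>R (z + h *\<^sub>R y))"
  \<comment> \<open>The derivative of \<open>?f\<close> in \<open>h\<close>, by the product rule;
    the factor \<open>l\<close> comes from the inner scaling of the argument of
    \<open>V\<close>.\<close>
  let ?f' = "\<lambda>h l. y \<bullet> V (l *\<^sub>R (z + h *\<^sub>R y)) + l * ((z + h *\<^sub>R y) \<bullet> D (l *\<^sub>R (z + h *\<^sub>R y)) y)"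
  have V': "((\<lambda>h. V (z + h *\<^sub>R w)) has_vector_derivative D (z + t *\<^sub>R w) w) (at t)" for z w t
    by (rule has_vector_derivative_along_line[where f' = "\<lambda>z. D z w"]) (rule V)
  note cV = continuous_on_compose2[OF contV _ subset_UNIV]
  note cD = continuous_on_compose2[OF contD _ subset_UNIV]
  have "((\<lambda>h. integral (cbox 0 1) (?f h)) has_vector_derivative integral (cbox 0 1) (?f' 0))
      (at 0 within UNIV)"
  proof (rule leibniz_rule_vector_derivative)
    fix h l :: real
    have "((\<lambda>h. V (l *\<^sub>R z + h *\<^sub>R (l *\<^sub>R y))) has_vector_derivative
        D (l *\<^sub>R z + h *\<^sub>R (l *\<^sub>R y)) (l *\<^sub>R y)) (at h)"
      by (rule V')
    then have *: "((\<lambda>h. V (l *\<^sub>R (z + h *\<^sub>R y))) has_vector_derivative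
        l *\<^sub>R D (l *\<^sub>R (z + h *\<^sub>R y)) y) (at h)"
      by (simp add: algebra_simps linear_scale[OF linD])
    have "((\<lambda>h. z + h *\<^sub>R y) has_vector_derivative y) (at h)"
      by (auto intro!: derivative_eq_intros simp: has_vector_derivative_def)
    from bounded_bilinear.has_vector_derivative[OF bounded_bilinear_inner this *]
    show "((\<lambda>h. ?f h l) has_vector_derivative ?f' h l) (at h within UNIV)"
      by (simp add: add.commute)
  next
    show "?f h integrable_on cbox 0 1" for h
      by (intro integrable_continuous continuous_intros cV)
    show "continuous_on (UNIV \<times> cbox 0 1) (\<lambda>(h, l). ?f' h l)"
      unfolding split_beta by (intro continuous_intros cV cD)
  qed auto
  moreover have "integral (cbox 0 1) (?f' 0) = V z \<bullet> y"
  proof -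
    have "((\<lambda>l. ?f' 0 l) has_integral (1 *\<^sub>R (y \<bullet> V (1 *\<^sub>R z)) - 0 *\<^sub>R (y \<bullet> V (0 *\<^sub>R z)))) {0..1}"
    proof (rule fundamental_theorem_of_calculus)
      fix l :: real
      have "((\<lambda>l. V (0 + l *\<^sub>R z)) has_vector_derivative D (0 + l *\<^sub>R z) z) (at l)"
        by (rule V')
      then have *: "((\<lambda>l. y \<bullet> V (l *\<^sub>R z)) has_vector_derivative y \<bullet> D (l *\<^sub>R z) z) (at l)"
        using bounded_linear.has_vector_derivative[OF bounded_linear_inner_right] by simp
      have "((\<lambda>l. l *\<^sub>R (y \<bullet> V (l *\<^sub>R z))) has_vector_derivative
          l *\<^sub>R (y \<bullet> D (l *\<^sub>R z) z) + 1 *\<^sub>R (y \<bullet> V (l *\<^sub>R z))) (at l)"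
        by (intro has_vector_derivative_scaleR * DERIV_ident)
      \<comment> \<open>Symmetry enters here: it exchanges \<open>z\<close> and \<open>y\<close> in
        the derivative term, so that \<open>?f' 0\<close> is recognised as the derivative of
        \<open>l\<close> times \<open>y \<bullet> V (l *\<^sub>R z)\<close>.\<close>
      then have "((\<lambda>l. l *\<^sub>R (y \<bullet> V (l *\<^sub>R z))) has_vector_derivative ?f' 0 l) (at l)"
        using sym[of "l *\<^sub>R z" z y] by (simp add: inner_commute algebra_simps)
      then show "((\<lambda>l. l *\<^sub>R (y \<bullet> V (l *\<^sub>R z))) has_vector_derivative ?f' 0 l) (at l within {0..1})"
        by (rule has_vector_derivative_at_within)
    qed simp
    then show ?thesis by (simp add: integral_unique inner_commute)
  qed
  ultimately show ?thesis
    by (simp add: has_real_derivative_iff_has_vector_derivative)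
qed

text \<open>Here \<open>V\<close> is the gradient of \<open>H\<close> and \<open>D\<close> its
  Hessian. Mixed partial derivatives give symmetry on pairs of basis vectors, and linearity of
  \<open>D z\<close> extends it to all vectors.\<close>

lemma potential_imp_symmetric_derivative:
  fixes V :: "'a::euclidean_space \<Rightarrow> 'a"
  assumes V: "\<And>z w. ((\<lambda>h. V (z + h *\<^sub>R w)) has_vector_derivative D z w) (at 0)"
    and contD: "\<And>w. continuous_on UNIV (\<lambda>z. D z w)"
    and linD: "\<And>z. linear (D z)"
    and H: "\<And>z k. k \<in> Basis \<Longrightarrow> ((\<lambda>h. H (z + h *\<^sub>R k)) has_real_derivative V z \<bullet> k) (at 0)"
  shows "D z w \<bullet> y = w \<bullet> D z y"
proof -
  have VD: "((\<lambda>h. V (z + h *\<^sub>R w) \<bullet> k) has_real_derivative D z w \<bullet> k) (at 0)" for z w k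
    using bounded_linear.has_vector_derivative[OF bounded_linear_inner_left V]
    by (simp add: has_real_derivative_iff_has_vector_derivative)
  have *: "D z i \<bullet> j = D z j \<bullet> i" if "i \<in> Basis" "j \<in> Basis" for i j
    using that contD
    by (intro mixed_partial_derivatives_commute[where H = H and u = j and v = i
        and r = "\<lambda>z. D z i \<bullet> j" and s = "\<lambda>z. D z j \<bullet> i",
        OF H H VD VD])
       (auto simp: continuous_on_eq_continuous_at intro!: continuous_inner)
  have D: "D z w = (\<Sum>i\<in>Basis. (w \<bullet> i) *\<^sub>R D z i)" for w
    using linear_sum[OF linD, of z "\<lambda>i. (w \<bullet> i) *\<^sub>R i" Basis] linear_scale[OF linD]
    by (simp add: euclidean_representation)
  have 1: "D z w \<bullet> y = (\<Sum>i\<in>Basis. \<Sum>j\<in>Basis. (w \<bullet> i) * (y \<bullet> j) * (D z i \<bullet> j))"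
    by (subst D, subst euclidean_representation[symmetric, of y])
       (simp add: inner_sum_left inner_sum_right sum_distrib_left mult_ac,
         rule sum.swap)
  have 2: "w \<bullet> D z y = (\<Sum>j\<in>Basis. \<Sum>i\<in>Basis. (w \<bullet> i) * (y \<bullet> j) * (D z j \<bullet> i))"
    by (subst D, subst euclidean_representation[symmetric, of w])
       (simp add: inner_sum_left inner_sum_right sum_distrib_left mult_ac inner_commute)
  have "(\<Sum>i\<in>Basis. \<Sum>j\<in>Basis. (w \<bullet> i) * (y \<bullet> j) * (D z i \<bullet> j))
      = (\<Sum>i\<in>Basis. \<Sum>j\<in>Basis. (w \<bullet> i) * (y \<bullet> j) * (D z j \<bullet> i))"
    by (intro sum.cong refl arg_cong2[where f = "(*)"] *)
  also have "\<dots> = (\<Sum>j\<in>Basis. \<Sum>i\<in>Basis. (w \<bullet> i) * (y \<bullet> j) * (D z j \<bullet> i))"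
    by (rule sum.swap)
  finally show ?thesis unfolding 1 2 .
qed


section \<open>Symmetry of the derivative of a Hamiltonian field\<close>

lemma symp_J_inner:
  fixes x y :: "'a::real_inner \<times> 'a"
  shows "symp_J x \<bullet> y = - (x \<bullet> symp_J y)"
  by (simp add: symp_J_def case_prod_beta inner_prod_def)

lemma linear_symp_J: "linear (symp_J :: 'a::real_vector \<times> 'a \<Rightarrow> _)"
  by (rule linearI) (auto simp: symp_J_def)

lemma linear_phase_deriv: "linear (phase_deriv f z)"
  by (rule linearI)
     (auto simp: phase_deriv_def algebra_simps scaleR_sum_right sum.distrib)

lemma dirderiv_eq_phase_deriv: "C1_map f \<Longrightarrow> dirderiv f w z = phase_deriv f z w"
  unfolding dirderiv_def by (intro vector_derivative_at phase_deriv_has_vector_derivative)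

lemma continuous_on_phase_deriv:
  assumes "C1_map f"
  shows "continuous_on UNIV (\<lambda>z. phase_deriv f z w)"
proof -
  have "continuous_on UNIV (dirderiv f (axis k 1, 0))"
    "continuous_on UNIV (dirderiv f (0, axis k 1))" for k
    using assms unfolding C1_map_def
    by (simp_all add: Basis_prod_def Basis_vec_def ball_Un image_iff)
  then show ?thesis
    by (cases w) (auto simp: phase_deriv_def intro!: continuous_intros)
qed

lemma C1_map_continuous_on: "C1_map f \<Longrightarrow> continuous_on S f"
  unfolding C1_map_def using differentiable_imp_continuous_on continuous_on_subset by blast

lemma phase_deriv_bounded_linear:
  assumes "bounded_linear L" "C1_map f"
  shows "phase_deriv (\<lambda>z. L (f z)) z w = L (phase_deriv f z w)"
proof -
  have "dirderiv (\<lambda>z. L (f z)) v z = L (dirderiv f v z)" for v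
    unfolding dirderiv_eq_phase_deriv[OF assms(2)] unfolding dirderiv_def
    by (intro vector_derivative_at bounded_linear.has_vector_derivative[OF assms(1)]
        phase_deriv_has_vector_derivative assms(2))
  with bounded_linear.linear[OF assms(1)] show ?thesis
    by (simp add: phase_deriv_def case_prod_beta linear_add linear_sum linear_scale)
qed

lemma C1_map_bounded_linear:
  fixes f :: "'d::finite phase \<Rightarrow> 'b::real_normed_vector"
  assumes "bounded_linear L" "C1_map f"
  shows "C1_map (\<lambda>z. L (f z))"
proof -
  have "dirderiv (\<lambda>z. L (f z)) v = (\<lambda>z. L (dirderiv f v z))" for v
    unfolding dirderiv_eq_phase_deriv[OF assms(2)] unfolding dirderiv_def
    by (intro ext vector_derivative_at bounded_linear.has_vector_derivative[OF assms(1)]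
        phase_deriv_has_vector_derivative assms(2))
  moreover have "(\<lambda>z. L (f z)) differentiable_on UNIV"
    using assms(2) bounded_linear.has_derivative[OF assms(1)]
    unfolding C1_map_def differentiable_on_def differentiable_def by blast
  ultimately show ?thesis
    using assms(2) unfolding C1_map_def
    by (auto intro: bounded_linear.continuous_on[OF assms(1)])
qed

lemma bounded_linear_column: "bounded_linear (column j :: real^'n^'d \<Rightarrow> real^'d)"
  by (auto simp: linear_conv_bounded_linear[symmetric] column_def vec_eq_iff intro!: linearI)

text \<open>In matrix terms, J^T times the Jacobian of \<open>(f, g)\<close> is symmetric, that is,
  the Jacobian lies in the symplectic Lie algebra. These are the Helmholtz conditions for a
  Hamiltonian vector field.\<close>

definition symp_symmetric ::
    "('d::finite phase \<Rightarrow> real^'d) \<Rightarrow> ('d phase \<Rightarrow> real^'d) \<Rightarrow> bool" where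
  "symp_symmetric f g \<longleftrightarrow> (\<forall>z w y.
     symp_J y \<bullet> (phase_deriv f z w, phase_deriv g z w)
       = symp_J w \<bullet> (phase_deriv f z y, phase_deriv g z y))"

text \<open>Hamilton's equations for a single pair of coefficients and a scalar Hamiltonian. The
  drift and each column of the noise are instances, so one argument serves for all of them.\<close>

definition potential_of ::
    "('d::finite phase \<Rightarrow> real) \<Rightarrow> ('d phase \<Rightarrow> real^'d) \<Rightarrow> ('d phase \<Rightarrow> real^'d) \<Rightarrow> bool" where
  "potential_of H f g \<longleftrightarrow> (\<forall>z i.
     ((\<lambda>h. H (z + h *\<^sub>R (0, axis i 1))) has_real_derivative f z $ i) (at 0) \<and>
     ((\<lambda>h. H (z + h *\<^sub>R (axis i 1, 0))) has_real_derivative - g z $ i) (at 0))"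

context
  fixes f g :: "'d::finite phase \<Rightarrow> real^'d"
  assumes C1: "C1_map f" "C1_map g"
begin

text \<open>The vector field \<open>- symp_J (f z, g z)\<close> is \<open>(- g z, f z)\<close>,
  which Hamilton's equations require to be the gradient of \<open>H\<close> in
  \<open>(Q, P)\<close>.\<close>

lemma symp_gradient_has_vector_derivative:
  "((\<lambda>h. - symp_J (f (z + h *\<^sub>R w), g (z + h *\<^sub>R w))) has_vector_derivative
     - symp_J (phase_deriv f z w, phase_deriv g z w)) (at 0)"
proof -
  have "bounded_linear (\<lambda>x :: 'd phase. - symp_J x)"
    by (auto simp: linear_conv_bounded_linear[symmetric] symp_J_def intro!: linearI)
  from bounded_linear.has_vector_derivative[OF this has_vector_derivative_Pair]
  show ?thesis using phase_deriv_has_vector_derivative C1 by blast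
qed

lemma continuous_on_symp_gradient_deriv:
  "continuous_on UNIV (\<lambda>z. - symp_J (phase_deriv f z w, phase_deriv g z w))"
  unfolding symp_J_def
  by (simp, intro continuous_intros continuous_on_phase_deriv C1)

lemma linear_symp_gradient_deriv:
  "linear (\<lambda>w. - symp_J (phase_deriv f z w, phase_deriv g z w))"
  using linear_phase_deriv[of f z] linear_phase_deriv[of g z]
  by (intro linearI) (auto simp: symp_J_def linear_add linear_scale)

text \<open>Since J^T = -J, the symplectic condition is ordinary symmetry of the derivative of the
  candidate gradient, the form used by the Schwarz and Poincare lemmas.\<close>

lemma symp_symmetric_iff:
  "symp_symmetric f g \<longleftrightarrow> (\<forall>z w y.
     - symp_J (phase_deriv f z w, phase_deriv g z w) \<bullet> y
       = w \<bullet> - symp_J (phase_deriv f z y, phase_deriv g z y))"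
  unfolding symp_symmetric_def by (simp add: symp_J_inner inner_commute del: inner_Pair)

lemma potential_imp_symp_symmetric:
  assumes "potential_of H f g"
  shows "symp_symmetric f g"
  unfolding symp_symmetric_iff
proof (intro allI)
  fix z w y
  show "- symp_J (phase_deriv f z w, phase_deriv g z w) \<bullet> y
       = w \<bullet> - symp_J (phase_deriv f z y, phase_deriv g z y)"
  proof (rule potential_imp_symmetric_derivative[where V = "\<lambda>z. - symp_J (f z, g z)" and H = H
        and D = "\<lambda>z w. - symp_J (phase_deriv f z w, phase_deriv g z w)"])
    fix z k :: "'d phase" assume "k \<in> Basis"
    then show "((\<lambda>h. H (z + h *\<^sub>R k)) has_real_derivative - symp_J (f z, g z) \<bullet> k) (at 0)"
      using assms
      by (cases z) (auto simp: potential_of_def symp_J_def Basis_prod_def Basis_vec_def inner_axis)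
  qed (rule symp_gradient_has_vector_derivative continuous_on_symp_gradient_deriv
      linear_symp_gradient_deriv)+
qed

lemma symp_symmetric_imp_potential:
  assumes "symp_symmetric f g"
  shows "potential_of (\<lambda>(q, p). integral {0..1} (\<lambda>l.
           p \<bullet> f (l *\<^sub>R q, l *\<^sub>R p) - q \<bullet> g (l *\<^sub>R q, l *\<^sub>R p))) f g"
proof -
  define V where "V = (\<lambda>z. - symp_J (f z, g z))"
  \<comment> \<open>The stated Hamiltonian is the ray potential of \<open>V\<close>, because
    \<open>V\<close> has components \<open>- g\<close> and \<open>f\<close>.\<close>
  have eq: "(case z of (q, p) \<Rightarrow> integral {0..1} (\<lambda>l.
           p \<bullet> f (l *\<^sub>R q, l *\<^sub>R p) - q \<bullet> g (l *\<^sub>R q, l *\<^sub>R p)))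
      = integral {0..1} (\<lambda>l. z \<bullet> V (l *\<^sub>R z))" for z
    by (cases z) (simp add: V_def symp_J_def)
  have "((\<lambda>h. integral {0..1} (\<lambda>l. (z + h *\<^sub>R y) \<bullet> V (l *\<^sub>R (z + h *\<^sub>R y))))
            has_real_derivative V z \<bullet> y) (at 0)" for z y
  proof (rule poincare_potential[where
        D = "\<lambda>z w. - symp_J (phase_deriv f z w, phase_deriv g z w)"])
    show "continuous_on UNIV V"
      unfolding V_def symp_J_def
      by (simp, intro continuous_intros C1_map_continuous_on C1)
  qed (use assms in \<open>unfold V_def symp_symmetric_iff, blast intro:
        symp_gradient_has_vector_derivative continuous_on_symp_gradient_deriv
        linear_symp_gradient_deriv\<close>)+
  from this[of _ "(0, axis _ 1)"] this[of _ "(axis _ 1, 0)"] show ?thesis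
    unfolding potential_of_def eq by (simp add: V_def symp_J_def inner_axis)
qed

end

section \<open>From one pair of coefficients to a whole stochastic field\<close>

definition symmetric_field :: "('d::finite, 'n::finite) stoch_field \<Rightarrow> bool" where
  "symmetric_field X \<longleftrightarrow> symp_symmetric (XQD X) (XPD X) \<and>
     (\<forall>j. symp_symmetric (\<lambda>z. column j (XQS X z)) (\<lambda>z. column j (XPS X z)))"

lemma is_hamiltonian_iff_potential_of:
  "is_hamiltonian X H\<^sub>D H\<^sub>S \<longleftrightarrow> potential_of H\<^sub>D (XQD X) (XPD X) \<and>
     (\<forall>j. potential_of (\<lambda>z. H\<^sub>S z $ j) (\<lambda>z. column j (XQS X z)) (\<lambda>z. column j (XPS X z)))"
  unfolding is_hamiltonian_def potential_of_def by (auto simp: column_def)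

context
  fixes X :: "('d::finite, 'n::finite) stoch_field"
  assumes X: "C1_field X"
begin

lemma C1_field_column:
  "C1_map (\<lambda>z. column j (XQS X z))" "C1_map (\<lambda>z. column j (XPS X z))"
  using X by (auto simp: C1_field_def intro!: C1_map_bounded_linear[OF bounded_linear_column])

lemma stoch_hamiltonian_imp_symmetric_field:
  assumes "stoch_hamiltonian X"
  shows "symmetric_field X"
  using assms X C1_field_column
  unfolding stoch_hamiltonian_def is_hamiltonian_iff_potential_of symmetric_field_def C1_field_def
  by (blast intro: potential_imp_symp_symmetric)

text \<open>Taking a component inside a vector-valued integral requires the integrand to be
  integrable; this follows from its continuity, checked component by component. The row-vector
  product then becomes an inner product with the columns.\<close>

lemma ham_S_nth:
  "ham_S X z $ j = (case z of (q, p) \<Rightarrow> integral {0..1} (\<lambda>l.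
     p \<bullet> column j (XQS X (l *\<^sub>R q, l *\<^sub>R p)) - q \<bullet> column j (XPS X (l *\<^sub>R q, l *\<^sub>R p))))"
proof -
  obtain q p where z: "z = (q, p)" by (cases z)
  let ?g = "\<lambda>l. p v* XQS X (l *\<^sub>R q, l *\<^sub>R p) - q v* XPS X (l *\<^sub>R q, l *\<^sub>R p)"
  have nth: "?g l $ j = p \<bullet> column j (XQS X (l *\<^sub>R q, l *\<^sub>R p)) - q \<bullet> column j (XPS X (l *\<^sub>R q, l *\<^sub>R p))"
    for l j
    by (simp add: vector_matrix_mult_def column_def inner_vec_def mult.commute)
  have "continuous_on {0..1} (\<lambda>l. ?g l $ j)" for j
    unfolding nth
    by (intro continuous_intros continuous_on_compose2[OF C1_map_continuous_on[OF C1_field_column(1)]]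
        continuous_on_compose2[OF C1_map_continuous_on[OF C1_field_column(2)]]) auto
  then have "continuous_on {0..1} ?g"
    by (simp add: continuous_on_componentwise[of _ ?g] Basis_vec_def inner_axis
        del: vector_minus_component)
  then have "integral {0..1} ?g $ j = integral {0..1} (\<lambda>l. ?g l $ j)"
    by (intro integral_component_eq_cart[symmetric] integrable_continuous_interval)
  then show ?thesis unfolding nth by (simp add: ham_S_def z)
qed

lemma symmetric_field_imp_is_hamiltonian:
  assumes "symmetric_field X"
  shows "is_hamiltonian X (ham_D X) (ham_S X)"
  unfolding is_hamiltonian_iff_potential_of ham_S_nth ham_D_def
  using assms X unfolding symmetric_field_def C1_field_def
  by (auto intro!: symp_symmetric_imp_potential C1_field_column)

lemma phase_deriv_column:
  "column j (phase_deriv (XQS X) z w) = phase_deriv (\<lambda>z. column j (XQS X z)) z w"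
  "column j (phase_deriv (XPS X) z w) = phase_deriv (\<lambda>z. column j (XPS X z)) z w"
  using X by (simp_all add: C1_field_def phase_deriv_bounded_linear[OF bounded_linear_column])

end


section \<open>Limits in probability along partitions\<close>

lemma interval_partition_mono:
  assumes "interval_partition s t N \<tau>" "i \<le> j" "j \<le> N"
  shows "\<tau> i \<le> \<tau> j"
  using assms(2,3)
proof (induction rule: dec_induct)
  case (step k)
  then have "\<tau> k < \<tau> (Suc k)"
    using assms(1) by (simp add: interval_partition_def)
  with step show ?case by simp
qed simp

lemma interval_partition_in_Icc:
  assumes "interval_partition s t N \<tau>" "i \<le> N"
  shows "\<tau> i \<in> {s..t}"
  using interval_partition_mono[OF assms(1), of 0 i] interval_partition_mono[OF assms(1), of i N]
    assms by (auto simp: interval_partition_def)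

text \<open>A uniform subdivision. Without arbitrarily fine partitions, convergence along the mesh
  would be vacuous and its limit would not be unique.\<close>

lemma interval_partition_fine:
  assumes "s < t" "0 < \<delta>"
  obtains N \<tau> where "interval_partition s t N \<tau>" "\<And>i. i < N \<Longrightarrow> \<tau> (Suc i) - \<tau> i < \<delta>"
proof -
  obtain n where "(t - s) / \<delta> < real n"
    using reals_Archimedean2[of "(t - s) / \<delta>"] by blast
  \<comment> \<open>Passing to \<open>Suc n\<close> pieces ensures that the number of pieces is
    positive.\<close>
  then have n: "(t - s) / \<delta> < real (Suc n)" by simp
  define \<tau> where "\<tau> i = s + real i * ((t - s) / Suc n)" for i
  have step: "\<tau> (Suc i) - \<tau> i = (t - s) / Suc n" for i
    unfolding \<tau>_def of_nat_Suc by (simp only: distrib_right)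
  have "0 < (t - s) / Suc n" "(t - s) / Suc n < \<delta>"
    using assms n by (simp_all add: field_simps)
  with step have *: "\<tau> i < \<tau> (Suc i)" "\<tau> (Suc i) - \<tau> i < \<delta>" for i
    by (metis diff_gt_0_iff_gt, simp)
  have "\<tau> 0 = s" "\<tau> (Suc n) = t"
    by (simp_all add: \<tau>_def)
  with * show thesis
    by (intro that[of "Suc n" \<tau>]) (simp_all add: interval_partition_def)
qed

section \<open>Convergence in probability: transfer, pathwise criterion, uniqueness\<close>

lemma tendsto_in_prob_mesh_cong:
  assumes "\<And>N \<tau> \<omega>. interval_partition s t N \<tau> \<Longrightarrow> \<omega> \<in> space M \<Longrightarrow> S N \<tau> \<omega> = S' N \<tau> \<omega>"
  shows "tendsto_in_prob_mesh M s t S I \<longleftrightarrow> tendsto_in_prob_mesh M s t S' I"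
proof -
  have 1: "S N \<tau> \<in> borel_measurable M \<longleftrightarrow> S' N \<tau> \<in> borel_measurable M"
    if "interval_partition s t N \<tau>" for N \<tau>
    using assms that by (intro measurable_cong) auto
  have 2: "{\<omega> \<in> space M. \<epsilon> < norm (S N \<tau> \<omega> - I \<omega>)} = {\<omega> \<in> space M. \<epsilon> < norm (S' N \<tau> \<omega> - I \<omega>)}"
    if "interval_partition s t N \<tau>" for N \<tau> \<epsilon>
    using assms that by auto
  show ?thesis
    unfolding tendsto_in_prob_mesh_def using 1 2 by (simp cong: conj_cong imp_cong)
qed

text \<open>Pathwise convergence implies convergence in probability. As the partitions do not form a
  sequence, the proof is by contradiction: a failure yields a sequence of bad partitions with mesh
  tending to 0, to which dominated convergence applies.\<close>

lemma (in prob_space) tendsto_in_prob_mesh_AE: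
  fixes S :: "nat \<Rightarrow> (nat \<Rightarrow> real) \<Rightarrow> 'a \<Rightarrow> 'b::euclidean_space"
  assumes I[measurable]: "I \<in> borel_measurable M"
    and S: "\<And>N \<tau>. interval_partition s t N \<tau> \<Longrightarrow> S N \<tau> \<in> borel_measurable M"
    and lim: "AE \<omega> in M. \<forall>e>0. \<exists>\<delta>>0. \<forall>N \<tau>. interval_partition s t N \<tau> \<and>
        (\<forall>i<N. \<tau> (Suc i) - \<tau> i < \<delta>) \<longrightarrow> norm (S N \<tau> \<omega> - I \<omega>) < e"
  shows "tendsto_in_prob_mesh M s t S I"
  unfolding tendsto_in_prob_mesh_def
proof (intro conjI I allI impI S)
  fix \<epsilon> :: real assume "0 < \<epsilon>"
  let ?A = "\<lambda>N \<tau>. {\<omega> \<in> space M. \<epsilon> < norm (S N \<tau> \<omega> - I \<omega>)}"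
  let ?P = "\<lambda>\<delta> N \<tau>. interval_partition s t N \<tau> \<and> (\<forall>i<N. \<tau> (Suc i) - \<tau> i < \<delta>)"
  show "\<exists>\<delta>>0. \<forall>N \<tau>. ?P \<delta> N \<tau> \<longrightarrow> measure M (?A N \<tau>) < \<epsilon>"
  proof (rule ccontr)
    assume "\<not> ?thesis"
    then have "\<exists>N \<tau>. ?P \<delta> N \<tau> \<and> \<epsilon> \<le> measure M (?A N \<tau>)" if "0 < \<delta>" for \<delta>
      using that by (simp only: not_le[symmetric]) blast
    moreover define Q where "Q n N \<tau> \<longleftrightarrow> ?P (1 / real (Suc n)) N \<tau> \<and> \<epsilon> \<le> measure M (?A N \<tau>)"
      for n N \<tau>
    ultimately have "\<forall>n. \<exists>N \<tau>. Q n N \<tau>"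
      by simp
    then obtain N \<tau> where "\<And>n. Q n (N n) (\<tau> n)"
      by metis
    then have P: "\<And>n. ?P (1 / real (Suc n)) (N n) (\<tau> n)"
      and A: "\<And>n. \<epsilon> \<le> measure M (?A (N n) (\<tau> n))"
      unfolding Q_def by blast+
    have [measurable]: "S (N n) (\<tau> n) \<in> borel_measurable M" for n
      using P S by blast
    \<comment> \<open>Almost every sample point eventually leaves the bad events, so their
      probabilities tend to 0, against the lower bound \<open>\<epsilon>\<close>.\<close>
    have "(\<lambda>n. \<integral>\<omega>. indicator (?A (N n) (\<tau> n)) \<omega> \<partial>M) \<longlonglongrightarrow> (\<integral>\<omega>. (0::real) \<partial>M)"
    proof (rule integral_dominated_convergence[where w = "\<lambda>_. 1"])
      show "AE \<omega> in M. (\<lambda>n. indicator (?A (N n) (\<tau> n)) \<omega> :: real) \<longlonglongrightarrow> 0"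
        using lim
      proof eventually_elim
        case (elim \<omega>)
        with \<open>0 < \<epsilon>\<close> obtain \<delta> where \<delta>: "\<delta> > 0"
          "\<And>N \<tau>. ?P \<delta> N \<tau> \<Longrightarrow> norm (S N \<tau> \<omega> - I \<omega>) < \<epsilon>" by meson
        obtain m where m: "1 / real (Suc m) < \<delta>"
          using \<open>\<delta> > 0\<close> nat_approx_posE by blast
        have "indicator (?A (N n) (\<tau> n)) \<omega> = (0::real)" if "m \<le> n" for n
        proof -
          have "1 / real (Suc n) \<le> 1 / real (Suc m)"
            using that by (simp add: frac_le)
          with m P[of n] have "?P \<delta> (N n) (\<tau> n)" by fastforce
          from \<delta>(2)[OF this] show ?thesis by simp
        qed
        then show ?case
          by (intro tendsto_eventually) (auto simp: eventually_sequentially)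
      qed
    qed (auto split: split_indicator)
    then have "(\<lambda>n. measure M (?A (N n) (\<tau> n))) \<longlonglongrightarrow> 0" by simp
    then have "\<epsilon> \<le> 0"
      by (rule LIMSEQ_le_const) (use A in blast)
    with \<open>0 < \<epsilon>\<close> show False by simp
  qed
qed

text \<open>Both limits are compared with the same sum on one partition fine enough for each of
  them; it exists because \<open>s < t\<close>.\<close>

lemma (in prob_space) tendsto_in_prob_mesh_unique:
  fixes I I' :: "'a \<Rightarrow> 'b::euclidean_space"
  assumes lim: "tendsto_in_prob_mesh M s t S I" "tendsto_in_prob_mesh M s t S I'" and "s < t"
  shows "AE \<omega> in M. I \<omega> = I' \<omega>"
proof -
  have [measurable]: "I \<in> borel_measurable M" "I' \<in> borel_measurable M"
    using lim by (auto simp: tendsto_in_prob_mesh_def)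
  \<comment> \<open>The accuracy \<open>\<epsilon>\<close> is kept separate from the threshold
    \<open>\<eta>\<close>, so that it can tend to 0 while \<open>\<eta>\<close> stays fixed.\<close>
  have le: "measure M {\<omega> \<in> space M. \<eta> < norm (I \<omega> - I' \<omega>)} \<le> 2 * \<epsilon>"
    if "0 < \<epsilon>" "2 * \<epsilon> \<le> \<eta>" for \<epsilon> \<eta>
  proof -
    obtain \<delta> where \<delta>: "\<delta> > 0" "\<And>N \<tau>. interval_partition s t N \<tau> \<and> (\<forall>i<N. \<tau> (Suc i) - \<tau> i < \<delta>) \<Longrightarrow>
        measure M {\<omega> \<in> space M. \<epsilon> < norm (S N \<tau> \<omega> - I \<omega>)} < \<epsilon>"
      using lim(1) \<open>0 < \<epsilon>\<close> unfolding tendsto_in_prob_mesh_def by meson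
    obtain \<delta>' where \<delta>': "\<delta>' > 0" "\<And>N \<tau>. interval_partition s t N \<tau> \<and> (\<forall>i<N. \<tau> (Suc i) - \<tau> i < \<delta>') \<Longrightarrow>
        measure M {\<omega> \<in> space M. \<epsilon> < norm (S N \<tau> \<omega> - I' \<omega>)} < \<epsilon>"
      using lim(2) \<open>0 < \<epsilon>\<close> unfolding tendsto_in_prob_mesh_def by meson
    obtain N \<tau> where N: "interval_partition s t N \<tau>"
        "\<And>i. i < N \<Longrightarrow> \<tau> (Suc i) - \<tau> i < min \<delta> \<delta>'"
      using interval_partition_fine[OF \<open>s < t\<close>, of "min \<delta> \<delta>'"] \<delta>(1) \<delta>'(1) by auto
    have [measurable]: "S N \<tau> \<in> borel_measurable M"
      using lim(1) N(1) by (simp add: tendsto_in_prob_mesh_def)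
    let ?A = "{\<omega> \<in> space M. \<epsilon> < norm (S N \<tau> \<omega> - I \<omega>)}"
    let ?A' = "{\<omega> \<in> space M. \<epsilon> < norm (S N \<tau> \<omega> - I' \<omega>)}"
    have "{\<omega> \<in> space M. \<eta> < norm (I \<omega> - I' \<omega>)} \<subseteq> ?A \<union> ?A'"
    proof safe
      fix \<omega> assume "\<eta> < norm (I \<omega> - I' \<omega>)" "\<not> \<epsilon> < norm (S N \<tau> \<omega> - I' \<omega>)"
      moreover have "norm (I \<omega> - I' \<omega>) \<le> norm (S N \<tau> \<omega> - I \<omega>) + norm (S N \<tau> \<omega> - I' \<omega>)"
        by (metis dist_norm dist_triangle3)
      ultimately show "\<epsilon> < norm (S N \<tau> \<omega> - I \<omega>)" using that by simp
    qed
    then have "measure M {\<omega> \<in> space M. \<eta> < norm (I \<omega> - I' \<omega>)} \<le> measure M (?A \<union> ?A')"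
      by (intro finite_measure_mono) auto
    also have "\<dots> \<le> measure M ?A + measure M ?A'"
      by (intro measure_Un_le) auto
    also have "\<dots> \<le> 2 * \<epsilon>"
      using \<delta>(2)[of N \<tau>] \<delta>'(2)[of N \<tau>] N by fastforce
    finally show ?thesis .
  qed
  have "measure M {\<omega> \<in> space M. \<eta> < norm (I \<omega> - I' \<omega>)} = 0" if "0 < \<eta>" for \<eta>
  proof (rule antisym[OF field_le_epsilon])
    fix e :: real assume "0 < e"
    have "measure M {\<omega> \<in> space M. \<eta> < norm (I \<omega> - I' \<omega>)} \<le> 2 * (min e \<eta> / 2)"
      using \<open>0 < e\<close> \<open>0 < \<eta>\<close> by (intro le) auto
    then show "measure M {\<omega> \<in> space M. \<eta> < norm (I \<omega> - I' \<omega>)} \<le> 0 + e" by simp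
  qed simp
  then have "AE \<omega> in M. \<not> 1 / real (Suc n) < norm (I \<omega> - I' \<omega>)" for n
    by (subst AE_iff_measurable[OF _ refl]) (simp_all add: emeasure_eq_measure)
  then have "AE \<omega> in M. \<forall>n. \<not> 1 / real (Suc n) < norm (I \<omega> - I' \<omega>)"
    by (simp add: AE_all_countable)
  then show ?thesis
  proof eventually_elim
    case (elim \<omega>)
    then have "\<not> 0 < norm (I \<omega> - I' \<omega>)" using nat_approx_posE by metis
    then show ?case by simp
  qed
qed


section \<open>Symmetry implies self-adjointness\<close>

text \<open>The average of two endpoint values makes the discrete product rule exact, without a
  quadratic remainder: this is the Stratonovich product rule before any limit. Antisymmetry of J
  accounts for the plus sign of the last sum.\<close>

lemma symp_summation_by_parts:
  fixes W Y :: "nat \<Rightarrow> 'a::real_inner \<times> 'a"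
  shows "(\<Sum>i<N. ((symp_J (Y i) + symp_J (Y (Suc i))) /\<^sub>R 2) \<bullet> (W (Suc i) - W i))
    = symp_J (Y N) \<bullet> W N - symp_J (Y 0) \<bullet> W 0
      + (\<Sum>i<N. ((symp_J (W i) + symp_J (W (Suc i))) /\<^sub>R 2) \<bullet> (Y (Suc i) - Y i))"
proof (induction N)
  case (Suc N)
  have *: "((symp_J y + symp_J y') /\<^sub>R 2) \<bullet> (w' - w) = symp_J y' \<bullet> w' - symp_J y \<bullet> w
      + ((symp_J w + symp_J w') /\<^sub>R 2) \<bullet> (y' - y)" for y y' w w' :: "'a \<times> 'a"
    unfolding inner_scaleR_left inner_add_left inner_diff_right
      symp_J_inner[of w] symp_J_inner[of w']
    by (simp add: inner_commute field_simps)
  show ?case unfolding sum.lessThan_Suc Suc *[of "Y N" "Y (Suc N)"] by simp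
qed simp

text \<open>The boundary terms vanish, so the approximating sums coincide on every partition. Hence
  both integrals have the same versions, existence included.\<close>

lemma has_strat_integral_symp_commute:
  assumes "\<And>\<omega>. \<omega> \<in> space M \<Longrightarrow> W a \<omega> = 0 \<and> W b \<omega> = 0"
  shows "has_strat_integral M a b (\<lambda>t \<omega>. symp_J (Y t \<omega>)) W I \<longleftrightarrow>
         has_strat_integral M a b (\<lambda>t \<omega>. symp_J (W t \<omega>)) Y I"
  unfolding has_strat_integral_def
proof (rule tendsto_in_prob_mesh_cong)
  fix N \<tau> \<omega> assume "interval_partition a b N \<tau>" "\<omega> \<in> space M"
  then show "(\<Sum>i<N. ((symp_J (Y (\<tau> i) \<omega>) + symp_J (Y (\<tau> (Suc i)) \<omega>)) /\<^sub>R 2)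
        \<bullet> (W (\<tau> (Suc i)) \<omega> - W (\<tau> i) \<omega>))
    = (\<Sum>i<N. ((symp_J (W (\<tau> i) \<omega>) + symp_J (W (\<tau> (Suc i)) \<omega>)) /\<^sub>R 2)
        \<bullet> (Y (\<tau> (Suc i)) \<omega> - Y (\<tau> i) \<omega>))"
    using assms symp_summation_by_parts[of "\<lambda>i. Y (\<tau> i) \<omega>" "\<lambda>i. W (\<tau> i) \<omega>" N]
    by (simp add: interval_partition_def)
qed

text \<open>The three terms of the two pairings are matched at the level of approximating sums or
  integrands, so the equivalence holds for every \<open>I\<close> and no convergence has to be
  established.\<close>

lemma symmetric_field_imp_J_self_adjoint:
  fixes M :: "'w measure" and X :: "('d::finite, 'n::finite) stoch_field"
  assumes "C1_field X" "symmetric_field X"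
  shows "J_self_adjoint M F B a b (D_field_op X R)"
  unfolding J_self_adjoint_def is_J_adjoint_def
proof (intro ballI allI)
  fix U V G K :: "real \<Rightarrow> 'w \<Rightarrow> real^'d" and I
  assume UV: "U \<in> strat_process_0 M F B a b" "V \<in> strat_process_0 M F B a b"
  let ?W = "pair_process U V" and ?Y = "pair_process G K"
  have "?W a \<omega> = 0 \<and> ?W b \<omega> = 0" if "\<omega> \<in> space M" for \<omega>
    using UV that by (simp add: strat_process_0_def pair_process_def zero_prod_def)
  note X = has_strat_integral_symp_commute[of M ?W a b, OF this]
  have D: "symp_J y \<bullet> (phase_deriv (XQD X) z w, phase_deriv (XPD X) z w)
       = symp_J w \<bullet> (phase_deriv (XQD X) z y, phase_deriv (XPD X) z y)" for z w y
    using assms(2) unfolding symmetric_field_def symp_symmetric_def by blast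
  have S: "symp_J y \<bullet> (column j (phase_deriv (XQS X) z w), column j (phase_deriv (XPS X) z w))
       = symp_J w \<bullet> (column j (phase_deriv (XQS X) z y), column j (phase_deriv (XPS X) z y))"
    for z w y j
    using assms(2) unfolding symmetric_field_def symp_symmetric_def phase_deriv_column[OF assms(1)]
    by blast
  show "has_J_pairing M B a b (D_field_op X R ?W) ?Y I \<longleftrightarrow>
        has_J_pairing M B a b (D_field_op X R ?Y) ?W I"
    unfolding has_J_pairing_def has_strat_pairing_def D_field_op_def field_sdiff_def
    by (simp add: X inner_minus_right D[of "?Y _ _"] S[of "?Y _ _"] del: inner_Pair uminus_Pair)
qed


section \<open>Test functions concentrating at the endpoints\<close>

text \<open>Densities whose first absolute moment about \<open>c\<close> tends to 0 converge to the
  Dirac mass at \<open>c\<close>, by a Chebyshev-type estimate.\<close>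

lemma integral_concentrating_kernel:
  fixes K :: "nat \<Rightarrow> real \<Rightarrow> real"
  assumes cont: "\<And>n. continuous_on {a..b} (K n)"
    and nonneg: "\<And>n t. t \<in> {a..b} \<Longrightarrow> 0 \<le> K n t"
    and mass: "\<And>n. (K n has_integral 1) {a..b}"
    and moment: "(\<lambda>n. integral {a..b} (\<lambda>t. K n t * \<bar>t - c\<bar>)) \<longlonglongrightarrow> 0"
    and g: "continuous_on {a..b} g" and c: "c \<in> {a..b}"
  shows "(\<lambda>n. integral {a..b} (\<lambda>t. K n t * g t)) \<longlonglongrightarrow> g c"
proof (rule LIMSEQ_I)
  fix e :: real assume "0 < e"
  from g c \<open>0 < e\<close> obtain \<delta> where \<delta>: "\<delta> > 0"
    "\<And>t. t \<in> {a..b} \<Longrightarrow> \<bar>t - c\<bar> < \<delta> \<Longrightarrow> \<bar>g t - g c\<bar> < e / 2"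
    unfolding continuous_on_iff dist_real_def by (meson half_gt_zero)
  have "compact ((\<lambda>t. g t - g c) ` {a..b})"
    by (intro compact_continuous_image continuous_intros g) auto
  then have "bounded ((\<lambda>t. g t - g c) ` {a..b})"
    by (rule compact_imp_bounded)
  then obtain A where A: "\<And>t. t \<in> {a..b} \<Longrightarrow> \<bar>g t - g c\<bar> \<le> A"
    unfolding bounded_iff by force
  have "0 \<le> A" using A[OF c] by simp
  \<comment> \<open>Near \<open>c\<close> continuity gives the first term; away from
    \<open>c\<close> the ratio of the distance to \<open>\<delta>\<close> is at least 1, so the
    global bound \<open>A\<close> may be multiplied by it. The resulting bound is affine in the
    distance to \<open>c\<close> and only involves the mass and the moment.\<close>
  have bound: "\<bar>g t - g c\<bar> \<le> e / 2 + A / \<delta> * \<bar>t - c\<bar>" if t: "t \<in> {a..b}" for t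
  proof (cases "\<bar>t - c\<bar> < \<delta>")
    case True
    moreover have "0 \<le> A / \<delta> * \<bar>t - c\<bar>" using \<open>0 \<le> A\<close> \<delta>(1) by simp
    ultimately show ?thesis using \<delta>(2)[OF t] by linarith
  next
    case False
    then have "A * 1 \<le> A * (\<bar>t - c\<bar> / \<delta>)"
      using \<open>0 \<le> A\<close> \<delta>(1) by (intro mult_left_mono) (simp_all add: field_simps)
    then show ?thesis using A[OF t] \<open>0 < e\<close> by simp
  qed
  have "(\<lambda>n. A / \<delta> * integral {a..b} (\<lambda>t. K n t * \<bar>t - c\<bar>)) \<longlonglongrightarrow> A / \<delta> * 0"
    by (intro tendsto_intros moment)
  then have "\<forall>\<^sub>F n in sequentially. A / \<delta> * integral {a..b} (\<lambda>t. K n t * \<bar>t - c\<bar>) < e / 2"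
    using \<open>0 < e\<close> by (intro order_tendstoD) auto
  then obtain n0 where n0: "\<And>n. n \<ge> n0 \<Longrightarrow> A / \<delta> * integral {a..b} (\<lambda>t. K n t * \<bar>t - c\<bar>) < e / 2"
    unfolding eventually_sequentially by blast
  show "\<exists>n0. \<forall>n\<ge>n0. norm (integral {a..b} (\<lambda>t. K n t * g t) - g c) < e"
  proof (intro exI allI impI)
    fix n assume "n0 \<le> n"
    have i1: "((\<lambda>t. K n t * g t) has_integral integral {a..b} (\<lambda>t. K n t * g t)) {a..b}"
      by (intro integrable_integral integrable_continuous_interval continuous_intros cont g)
    have "((\<lambda>t. K n t * g c) has_integral 1 * g c) {a..b}"
      by (intro has_integral_mult_left mass)
    from has_integral_diff[OF i1 this]
    have i2: "((\<lambda>t. K n t * (g t - g c)) has_integral integral {a..b} (\<lambda>t. K n t * g t) - g c) {a..b}"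
      by (simp add: algebra_simps)
    have "((\<lambda>t. K n t * \<bar>t - c\<bar>) has_integral integral {a..b} (\<lambda>t. K n t * \<bar>t - c\<bar>)) {a..b}"
      by (intro integrable_integral integrable_continuous_interval continuous_intros cont)
    from has_integral_mult_right[OF this, of "A / \<delta>"] has_integral_mult_right[OF mass, of "e / 2" n]
    have i3: "((\<lambda>t. K n t * (e / 2 + A / \<delta> * \<bar>t - c\<bar>)) has_integral
        e / 2 + A / \<delta> * integral {a..b} (\<lambda>t. K n t * \<bar>t - c\<bar>)) {a..b}"
      by (auto dest: has_integral_add simp: algebra_simps)
    have "norm (integral {a..b} (\<lambda>t. K n t * (g t - g c)))
        \<le> integral {a..b} (\<lambda>t. K n t * (e / 2 + A / \<delta> * \<bar>t - c\<bar>))"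
      using i2 i3 bound nonneg
      by (intro integral_norm_bound_integral) (auto simp: abs_mult intro!: mult_left_mono)
    also have "\<dots> = e / 2 + A / \<delta> * integral {a..b} (\<lambda>t. K n t * \<bar>t - c\<bar>)"
      using i3 by (rule integral_unique)
    also have "\<dots> < e"
      using n0[OF \<open>n0 \<le> n\<close>] by linarith
    finally show "norm (integral {a..b} (\<lambda>t. K n t * g t) - g c) < e"
      using i2 by (simp add: integral_unique)
  qed
qed

text \<open>Polynomials that vanish at \<open>a\<close> and \<open>b\<close> and tend to 1 at every
  interior point, as each power tends to 0 away from one endpoint.\<close>

definition bump :: "real \<Rightarrow> real \<Rightarrow> nat \<Rightarrow> real \<Rightarrow> real" where
  "bump a b n t = 1 - ((b - t) / (b - a)) ^ Suc n - ((t - a) / (b - a)) ^ Suc n"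

text \<open>The derivative of \<open>bump\<close> is a difference of two probability densities on
  the interval, concentrating at \<open>a\<close> and at \<open>b\<close> respectively.\<close>

definition bump' :: "real \<Rightarrow> real \<Rightarrow> nat \<Rightarrow> real \<Rightarrow> real" where
  "bump' a b n t = Suc n / (b - a) * ((b - t) / (b - a)) ^ n
     - Suc n / (b - a) * ((t - a) / (b - a)) ^ n"

context
  fixes a b :: real
  assumes "a < b"
begin

lemma bump_endpoints: "bump a b n a = 0" "bump a b n b = 0"
  using \<open>a < b\<close> by (simp_all add: bump_def)

lemma DERIV_ratio_power:
  "((\<lambda>t. ((t - a) / (b - a)) ^ Suc n) has_real_derivative
     Suc n / (b - a) * ((t - a) / (b - a)) ^ n) (at t)"
  "((\<lambda>t. ((b - t) / (b - a)) ^ Suc n) has_real_derivative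
     - (Suc n / (b - a) * ((b - t) / (b - a)) ^ n)) (at t)"
proof -
  have "((\<lambda>t. (t - a) / (b - a)) has_real_derivative (1 - 0) / (b - a)) (at t)"
    "((\<lambda>t. (b - t) / (b - a)) has_real_derivative (0 - 1) / (b - a)) (at t)"
    by (intro DERIV_cdivide DERIV_diff DERIV_const DERIV_ident)+
  from this[THEN DERIV_power, of "Suc n"]
  show "((\<lambda>t. ((t - a) / (b - a)) ^ Suc n) has_real_derivative
     Suc n / (b - a) * ((t - a) / (b - a)) ^ n) (at t)"
  "((\<lambda>t. ((b - t) / (b - a)) ^ Suc n) has_real_derivative
     - (Suc n / (b - a) * ((b - t) / (b - a)) ^ n)) (at t)"
    by (simp_all del: power_Suc of_nat_Suc)
qed

lemma bump_has_derivative: "(bump a b n has_real_derivative bump' a b n t) (at t)"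
proof -
  have "(bump a b n has_real_derivative 0 - - (Suc n / (b - a) * ((b - t) / (b - a)) ^ n)
      - Suc n / (b - a) * ((t - a) / (b - a)) ^ n) (at t)"
    unfolding bump_def by (intro DERIV_diff DERIV_const DERIV_ratio_power)
  then show ?thesis by (simp add: bump'_def)
qed

lemma continuous_on_bump': "continuous_on S (bump' a b n)"
  unfolding bump'_def by (intro continuous_intros) (use \<open>a < b\<close> in auto)

text \<open>Mass and first absolute moment about \<open>b\<close> of the density concentrating
  there; the moment is of order \<open>1 / n\<close>.\<close>

lemma right_kernel_integrals:
  "((\<lambda>t. Suc n / (b - a) * ((t - a) / (b - a)) ^ n) has_integral 1) {a..b}"
  "((\<lambda>t. Suc n / (b - a) * ((t - a) / (b - a)) ^ n * \<bar>t - b\<bar>) has_integral (b - a) / real (n + 2)) {a..b}"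
proof -
  have "((\<lambda>t. Suc n / (b - a) * ((t - a) / (b - a)) ^ n) has_integral
      ((b - a) / (b - a)) ^ Suc n - ((a - a) / (b - a)) ^ Suc n) {a..b}"
    using \<open>a < b\<close> DERIV_ratio_power(1)
    by (intro fundamental_theorem_of_calculus)
       (auto simp del: power_Suc simp: has_real_derivative_iff_has_vector_derivative[symmetric]
         intro: has_field_derivative_at_within)
  then show "((\<lambda>t. Suc n / (b - a) * ((t - a) / (b - a)) ^ n) has_integral 1) {a..b}"
    using \<open>a < b\<close> by simp
  \<comment> \<open>An antiderivative found by integrating by parts, with
    \<open>\<bar>t - b\<bar> = b - t\<close> on the interval.\<close>
  let ?G = "\<lambda>t. ((t - a) / (b - a)) ^ Suc n * (b - t) + (b - a) / real (n + 2) * ((t - a) / (b - a)) ^ Suc (Suc n)"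
  have "((\<lambda>t. Suc n / (b - a) * ((t - a) / (b - a)) ^ n * \<bar>t - b\<bar>) has_integral ?G b - ?G a) {a..b}"
  proof (rule fundamental_theorem_of_calculus)
    fix t assume "t \<in> {a..b}"
    have "(?G has_real_derivative (Suc n / (b - a) * ((t - a) / (b - a)) ^ n * (b - t))) (at t)"
    proof -
      have "(?G has_real_derivative
          Suc n / (b - a) * ((t - a) / (b - a)) ^ n * (b - t) + (0 - 1) * ((t - a) / (b - a)) ^ Suc n
          + (b - a) / real (n + 2) * (Suc (Suc n) / (b - a) * ((t - a) / (b - a)) ^ Suc n)) (at t)"
        by (intro DERIV_add DERIV_mult DERIV_cmult DERIV_diff DERIV_const DERIV_ident DERIV_ratio_power)
      then show ?thesis using \<open>a < b\<close> by simp
    qed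
    then show "(?G has_vector_derivative Suc n / (b - a) * ((t - a) / (b - a)) ^ n * \<bar>t - b\<bar>)
        (at t within {a..b})"
      using \<open>t \<in> {a..b}\<close>
      by (auto simp: has_real_derivative_iff_has_vector_derivative[symmetric]
          intro: has_field_derivative_at_within)
  qed (use \<open>a < b\<close> in simp)
  then show "((\<lambda>t. Suc n / (b - a) * ((t - a) / (b - a)) ^ n * \<bar>t - b\<bar>) has_integral (b - a) / real (n + 2)) {a..b}"
    using \<open>a < b\<close> by simp
qed

text \<open>The mirror image for the density concentrating at \<open>a\<close>.\<close>

lemma left_kernel_integrals:
  "((\<lambda>t. Suc n / (b - a) * ((b - t) / (b - a)) ^ n) has_integral 1) {a..b}"
  "((\<lambda>t. Suc n / (b - a) * ((b - t) / (b - a)) ^ n * \<bar>t - a\<bar>) has_integral (b - a) / real (n + 2)) {a..b}"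
proof -
  have "((\<lambda>t. Suc n / (b - a) * ((b - t) / (b - a)) ^ n) has_integral
      - (((b - b) / (b - a)) ^ Suc n) - - (((b - a) / (b - a)) ^ Suc n)) {a..b}"
    using \<open>a < b\<close> DERIV_minus[OF DERIV_ratio_power(2)]
    by (intro fundamental_theorem_of_calculus)
       (auto simp del: power_Suc simp: has_real_derivative_iff_has_vector_derivative[symmetric]
         intro: has_field_derivative_at_within)
  then show "((\<lambda>t. Suc n / (b - a) * ((b - t) / (b - a)) ^ n) has_integral 1) {a..b}"
    using \<open>a < b\<close> by simp
  let ?G = "\<lambda>t. - (((b - t) / (b - a)) ^ Suc n * (t - a)) - (b - a) / real (n + 2) * ((b - t) / (b - a)) ^ Suc (Suc n)"
  have "((\<lambda>t. Suc n / (b - a) * ((b - t) / (b - a)) ^ n * \<bar>t - a\<bar>) has_integral ?G b - ?G a) {a..b}"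
  proof (rule fundamental_theorem_of_calculus)
    fix t assume "t \<in> {a..b}"
    have "(?G has_real_derivative (Suc n / (b - a) * ((b - t) / (b - a)) ^ n * (t - a))) (at t)"
    proof -
      have "(?G has_real_derivative
          - (- (Suc n / (b - a) * ((b - t) / (b - a)) ^ n) * (t - a) + (1 - 0) * ((b - t) / (b - a)) ^ Suc n)
          - (b - a) / real (n + 2) * - (Suc (Suc n) / (b - a) * ((b - t) / (b - a)) ^ Suc n)) (at t)"
        by (intro DERIV_diff DERIV_minus DERIV_mult DERIV_cmult DERIV_const DERIV_ident DERIV_ratio_power)
      then show ?thesis using \<open>a < b\<close> by simp
    qed
    then show "(?G has_vector_derivative Suc n / (b - a) * ((b - t) / (b - a)) ^ n * \<bar>t - a\<bar>)
        (at t within {a..b})"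
      using \<open>t \<in> {a..b}\<close>
      by (auto simp: has_real_derivative_iff_has_vector_derivative[symmetric]
          intro: has_field_derivative_at_within)
  qed (use \<open>a < b\<close> in simp)
  then show "((\<lambda>t. Suc n / (b - a) * ((b - t) / (b - a)) ^ n * \<bar>t - a\<bar>) has_integral (b - a) / real (n + 2)) {a..b}"
    using \<open>a < b\<close> by simp
qed

lemma integral_bump'_tendsto:
  assumes g: "continuous_on {a..b} g"
  shows "(\<lambda>n. integral {a..b} (\<lambda>t. bump' a b n t * g t)) \<longlonglongrightarrow> g a - g b"
proof -
  let ?l = "\<lambda>n t. Suc n / (b - a) * ((b - t) / (b - a)) ^ n"
  let ?r = "\<lambda>n t. Suc n / (b - a) * ((t - a) / (b - a)) ^ n"
  have cont: "continuous_on {a..b} (?l n)" "continuous_on {a..b} (?r n)" for n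
    using \<open>a < b\<close> by (auto intro!: continuous_intros)
  have lim: "(\<lambda>n. (b - a) / real (n + 2)) \<longlonglongrightarrow> 0"
    by (rule LIMSEQ_ignore_initial_segment[OF lim_const_over_n])
  have "(\<lambda>n. integral {a..b} (\<lambda>t. ?l n t * g t)) \<longlonglongrightarrow> g a"
    using \<open>a < b\<close> lim
    by (intro integral_concentrating_kernel[OF cont(1) _ left_kernel_integrals(1) _ g])
       (simp_all only: integral_unique[OF left_kernel_integrals(2)], auto simp: add.commute)
  moreover have "(\<lambda>n. integral {a..b} (\<lambda>t. ?r n t * g t)) \<longlonglongrightarrow> g b"
    using \<open>a < b\<close> lim
    by (intro integral_concentrating_kernel[OF cont(2) _ right_kernel_integrals(1) _ g])
       (simp_all only: integral_unique[OF right_kernel_integrals(2)], auto simp: add.commute)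
  ultimately have "(\<lambda>n. integral {a..b} (\<lambda>t. ?l n t * g t) - integral {a..b} (\<lambda>t. ?r n t * g t))
      \<longlonglongrightarrow> g a - g b"
    by (rule tendsto_diff)
  also have "(\<lambda>n. integral {a..b} (\<lambda>t. ?l n t * g t) - integral {a..b} (\<lambda>t. ?r n t * g t))
      = (\<lambda>n. integral {a..b} (\<lambda>t. bump' a b n t * g t))"
    unfolding bump'_def left_diff_distrib
    by (intro ext integral_diff[symmetric] integrable_continuous_interval continuous_intros cont g)
  finally show ?thesis .
qed

text \<open>Integration by parts against the identity function reduces this to
  \<open>integral_bump'_tendsto\<close> with \<open>g t = t\<close>.\<close>

lemma integral_bump_tendsto: "(\<lambda>n. integral {a..b} (bump a b n)) \<longlonglongrightarrow> b - a"
proof -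
  have cont: "continuous_on {a..b} (bump a b n)" for n
    unfolding bump_def using \<open>a < b\<close> by (auto intro!: continuous_intros)
  have "integral {a..b} (bump a b n) = - integral {a..b} (\<lambda>t. bump' a b n t * t)" for n
  proof -
    have "((\<lambda>t. bump' a b n t * t + bump a b n t) has_integral
        bump a b n b * b - bump a b n a * a) {a..b}"
      using \<open>a < b\<close>
      by (intro fundamental_theorem_of_calculus)
         (auto intro!: derivative_eq_intros bump_has_derivative[THEN DERIV_subset]
           simp: has_real_derivative_iff_has_vector_derivative[symmetric])
    then have "0 = integral {a..b} (\<lambda>t. bump' a b n t * t + bump a b n t)"
      by (simp add: integral_unique bump_endpoints)
    also have "\<dots> = integral {a..b} (\<lambda>t. bump' a b n t * t) + integral {a..b} (bump a b n)"
      by (intro integral_add integrable_continuous_interval continuous_intros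
          continuous_on_bump' cont)
    finally show ?thesis by simp
  qed
  moreover have "(\<lambda>n. - integral {a..b} (\<lambda>t. bump' a b n t * t)) \<longlonglongrightarrow> - (a - b)"
    by (intro tendsto_minus integral_bump'_tendsto continuous_intros)
  ultimately show ?thesis by simp
qed

end


section \<open>Stratonovich integrals of deterministic integrands\<close>

lemma trapezoid_summation_by_parts:
  fixes f g :: "nat \<Rightarrow> real"
  shows "(\<Sum>i<N. (f i + f (Suc i)) / 2 * (g (Suc i) - g i))
    = f N * g N - f 0 * g 0 - (\<Sum>i<N. (g i + g (Suc i)) / 2 * (f (Suc i) - f i))"
  by (induction N) (simp_all add: field_simps)

lemma integral_interval_partition:
  fixes f :: "real \<Rightarrow> real"
  assumes "interval_partition s t N \<tau>" "f integrable_on {s..t}"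
  shows "integral {s..t} f = (\<Sum>i<N. integral {\<tau> i..\<tau> (Suc i)} f)"
proof -
  have "integral {s..\<tau> k} f = (\<Sum>i<k. integral {\<tau> i..\<tau> (Suc i)} f)" if "k \<le> N" for k
    using that
  proof (induction k)
    case 0
    then show ?case using assms(1) by (simp add: interval_partition_def)
  next
    case (Suc k)
    have "s \<le> \<tau> k" "\<tau> k \<le> \<tau> (Suc k)" "\<tau> (Suc k) \<le> t"
      using interval_partition_in_Icc[OF assms(1), of k] Suc.prems
        interval_partition_in_Icc[OF assms(1), of "Suc k"]
        interval_partition_mono[OF assms(1), of k "Suc k"] by auto
    then have "integral {s..\<tau> k} f + integral {\<tau> k..\<tau> (Suc k)} f = integral {s..\<tau> (Suc k)} f"
      by (intro Henstock_Kurzweil_Integration.integral_combine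
          integrable_on_subinterval[OF assms(2)]) auto
    with Suc show ?case by simp
  qed
  from this[of N] assms(1) show ?thesis by (simp add: interval_partition_def)
qed

text \<open>Summation by parts moves the increments from \<open>\<beta>\<close> to the
  differentiable \<open>\<phi>\<close>. For this reason uniform continuity of \<open>\<beta>\<close>
  suffices, and the lemma applies to Brownian paths.\<close>

lemma trapezoid_sums_converge:
  fixes \<phi> \<phi>' \<beta> :: "real \<Rightarrow> real"
  assumes "a < b"
    and \<phi>: "\<And>t. t \<in> {a..b} \<Longrightarrow> (\<phi> has_real_derivative \<phi>' t) (at t)"
    and \<phi>': "continuous_on {a..b} \<phi>'" and \<beta>: "continuous_on {a..b} \<beta>"
    and ends: "\<phi> a = 0" "\<phi> b = 0" and "0 < e"
  shows "\<exists>\<delta>>0. \<forall>N \<tau>. interval_partition a b N \<tau> \<and> (\<forall>i<N. \<tau> (Suc i) - \<tau> i < \<delta>) \<longrightarrow>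
    \<bar>(\<Sum>i<N. (\<phi> (\<tau> i) + \<phi> (\<tau> (Suc i))) / 2 * (\<beta> (\<tau> (Suc i)) - \<beta> (\<tau> i)))
      - (- integral {a..b} (\<lambda>t. \<phi>' t * \<beta> t))\<bar> < e"
proof -
  have "bounded (\<phi>' ` {a..b})"
    by (intro compact_imp_bounded compact_continuous_image \<phi>') auto
  then obtain K where K: "K > 0" "\<And>t. t \<in> {a..b} \<Longrightarrow> \<bar>\<phi>' t\<bar> \<le> K"
    unfolding bounded_pos by force
  \<comment> \<open>Chosen so that the errors \<open>K * \<eta> * (t - s)\<close> of the pieces add
    up to \<open>e / 2\<close>.\<close>
  define \<eta> where "\<eta> = e / (2 * K * (b - a))"
  have "0 < \<eta>" using K \<open>a < b\<close> \<open>0 < e\<close> by (simp add: \<eta>_def)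
  have "uniformly_continuous_on {a..b} \<beta>"
    by (intro compact_uniformly_continuous \<beta>) auto
  then obtain \<delta> where \<delta>: "\<delta> > 0"
    "\<And>s t. s \<in> {a..b} \<Longrightarrow> t \<in> {a..b} \<Longrightarrow> \<bar>t - s\<bar> < \<delta> \<Longrightarrow> \<bar>\<beta> t - \<beta> s\<bar> < \<eta>"
    using \<open>0 < \<eta>\<close> unfolding uniformly_continuous_on_def dist_real_def by meson
  \<comment> \<open>The increment of \<open>\<phi>\<close> is the integral of
    \<open>\<phi>'\<close>, so the error on a piece is the integral of \<open>\<phi>'\<close> times
    the deviation of \<open>\<beta>\<close> from the average of its endpoint values.\<close>
  have piece: "\<bar>integral {s..t} (\<lambda>x. \<phi>' x * \<beta> x) - (\<beta> s + \<beta> t) / 2 * (\<phi> t - \<phi> s)\<bar> \<le> K * \<eta> * (t - s)"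
    if st: "a \<le> s" "s \<le> t" "t \<le> b" "t - s < \<delta>" for s t
  proof -
    have sub: "{s..t} \<subseteq> {a..b}" using st by auto
    note c = continuous_on_subset[OF \<phi>' sub] continuous_on_subset[OF \<beta> sub]
    have "(\<phi>' has_integral \<phi> t - \<phi> s) {s..t}"
      using st \<phi> by (intro fundamental_theorem_of_calculus)
        (auto simp: has_real_derivative_iff_has_vector_derivative[symmetric]
          intro: has_field_derivative_at_within)
    from has_integral_mult_right[OF this]
    have 1: "((\<lambda>x. (\<beta> s + \<beta> t) / 2 * \<phi>' x) has_integral (\<beta> s + \<beta> t) / 2 * (\<phi> t - \<phi> s)) {s..t}" .
    have 2: "((\<lambda>x. \<phi>' x * \<beta> x) has_integral integral {s..t} (\<lambda>x. \<phi>' x * \<beta> x)) {s..t}"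
      by (intro integrable_integral integrable_continuous_interval continuous_intros c)
    have "((\<lambda>x. \<phi>' x * (\<beta> x - (\<beta> s + \<beta> t) / 2)) has_integral
        integral {s..t} (\<lambda>x. \<phi>' x * \<beta> x) - (\<beta> s + \<beta> t) / 2 * (\<phi> t - \<phi> s)) {s..t}"
      using has_integral_diff[OF 2 1] by (simp add: algebra_simps)
    then have "integral {s..t} (\<lambda>x. \<phi>' x * \<beta> x) - (\<beta> s + \<beta> t) / 2 * (\<phi> t - \<phi> s)
        = integral {s..t} (\<lambda>x. \<phi>' x * (\<beta> x - (\<beta> s + \<beta> t) / 2))"
      by (rule integral_unique[symmetric])
    also have "norm \<dots> \<le> K * \<eta> * (t - s)"
    proof (rule integral_bound[OF \<open>s \<le> t\<close>])
      show "continuous_on {s..t} (\<lambda>x. \<phi>' x * (\<beta> x - (\<beta> s + \<beta> t) / 2))"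
        by (intro continuous_intros c)
      fix x assume x: "x \<in> {s..t}"
      then have "\<bar>\<beta> x - \<beta> s\<bar> < \<eta>" "\<bar>\<beta> x - \<beta> t\<bar> < \<eta>"
        using st by (auto intro!: \<delta>(2))
      then have "\<bar>\<beta> x - (\<beta> s + \<beta> t) / 2\<bar> \<le> \<eta>" by (simp add: abs_if field_simps split: if_splits)
      moreover have "\<bar>\<phi>' x\<bar> \<le> K" using x sub K(2) by blast
      ultimately show "norm (\<phi>' x * (\<beta> x - (\<beta> s + \<beta> t) / 2)) \<le> K * \<eta>"
        using K(1) by (auto simp: abs_mult intro!: mult_mono)
    qed
    finally show ?thesis by simp
  qed
  show ?thesis
  proof (intro exI conjI allI impI, rule \<open>\<delta> > 0\<close>)
    fix N \<tau> assume \<tau>: "interval_partition a b N \<tau> \<and> (\<forall>i<N. \<tau> (Suc i) - \<tau> i < \<delta>)"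
    then have part: "interval_partition a b N \<tau>" by simp
    have "(\<lambda>t. \<phi>' t * \<beta> t) integrable_on {a..b}"
      by (intro integrable_continuous_interval continuous_intros \<phi>' \<beta>)
    note int = integral_interval_partition[OF part this]
    have end\<tau>: "\<tau> 0 = a" "\<tau> N = b" using part by (auto simp: interval_partition_def)
    have "(\<Sum>i<N. (\<phi> (\<tau> i) + \<phi> (\<tau> (Suc i))) / 2 * (\<beta> (\<tau> (Suc i)) - \<beta> (\<tau> i)))
        - (- integral {a..b} (\<lambda>t. \<phi>' t * \<beta> t))
      = (\<Sum>i<N. integral {\<tau> i..\<tau> (Suc i)} (\<lambda>t. \<phi>' t * \<beta> t)
          - (\<beta> (\<tau> i) + \<beta> (\<tau> (Suc i))) / 2 * (\<phi> (\<tau> (Suc i)) - \<phi> (\<tau> i)))"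
      unfolding int sum_subtractf
      using trapezoid_summation_by_parts[of "\<lambda>i. \<phi> (\<tau> i)" "\<lambda>i. \<beta> (\<tau> i)" N]
      by (simp add: end\<tau> ends)
    also have "\<bar>\<dots>\<bar> \<le> (\<Sum>i<N. K * \<eta> * (\<tau> (Suc i) - \<tau> i))"
    proof (intro sum_abs[THEN order_trans] sum_mono piece)
      fix i assume "i \<in> {..<N}"
      with \<tau> interval_partition_in_Icc[OF part, of i] interval_partition_in_Icc[OF part, of "Suc i"]
        interval_partition_mono[OF part, of i "Suc i"]
      show "a \<le> \<tau> i" "\<tau> i \<le> \<tau> (Suc i)" "\<tau> (Suc i) \<le> b" "\<tau> (Suc i) - \<tau> i < \<delta>" by auto
    qed
    also have "\<dots> = K * \<eta> * (b - a)"
      unfolding sum_distrib_left[symmetric] sum_lessThan_telescope end\<tau> ..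
    also have "\<dots> = e / 2"
      using K \<open>a < b\<close> by (simp add: \<eta>_def field_simps)
    also have "\<dots> < e"
      using \<open>0 < e\<close> by simp
    finally show "\<bar>(\<Sum>i<N. (\<phi> (\<tau> i) + \<phi> (\<tau> (Suc i))) / 2 * (\<beta> (\<tau> (Suc i)) - \<beta> (\<tau> i)))
        - (- integral {a..b} (\<lambda>t. \<phi>' t * \<beta> t))\<bar> < e" .
  qed
qed

section \<open>Deterministic paths as Stratonovich processes\<close>

lemma tendsto_in_prob_mesh_zero: "tendsto_in_prob_mesh M s t (\<lambda>_ _ _. 0) (\<lambda>_. 0)"
  unfolding tendsto_in_prob_mesh_def by (auto intro!: exI[of _ 1])

text \<open>Take zero noise and a drift that depends on time alone. This supplies both kinds of test
  process, the constants and the deterministic multiples of a fixed vector.\<close>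

lemma deterministic_strat_process:
  fixes c u :: "'a::euclidean_space" and \<phi> :: "real \<Rightarrow> real" and B :: "real \<Rightarrow> 'w \<Rightarrow> real^'n"
  assumes \<phi>: "\<And>t. t \<in> {a..b} \<Longrightarrow> (\<phi> has_real_derivative \<phi>' t) (at t)"
    and \<phi>': "continuous_on {a..b} \<phi>'"
  shows "(\<lambda>t \<omega>. c + \<phi> t *\<^sub>R u) \<in> strat_process M F B a b"
proof -
  let ?\<sigma> = "\<lambda>(t::real) (x::'a). 0 :: 'a^'n"
  have corr: "strat_correction ?\<sigma> s x = 0" for s x
    by (simp add: strat_correction_def)
  have "dirderiv (\<lambda>x::'a. 0 :: 'a^'n) k x = 0" for k x
    by (simp add: dirderiv_def)
  then have \<sigma>: "continuous_on UNIV (\<lambda>(t, x). dirderiv (?\<sigma> t) k x)" for k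
    by (simp add: case_prod_beta)
  have ito: "has_ito_integral M B a t (\<lambda>s \<omega>. 0 :: 'a^'n) (\<lambda>_. 0)" for t
    by (simp add: has_ito_integral_def tendsto_in_prob_mesh_zero)
  have cont: "continuous_on {a..b} (\<lambda>t. c + \<phi> t *\<^sub>R u)"
    by (intro continuous_intros DERIV_atLeastAtMost_imp_continuous_on)
       (use \<phi> in auto)
  have int: "(LINT s:{a..t}|lborel. \<phi>' s *\<^sub>R u + strat_correction ?\<sigma> s (c + \<phi> s *\<^sub>R u))
      = \<phi> t *\<^sub>R u - \<phi> a *\<^sub>R u" if "t \<in> {a..b}" for t
    unfolding set_lebesgue_integral_def corr add_0_right
  proof (rule integral_FTC_atLeastAtMost)
    fix x assume "a \<le> x" "x \<le> t"
    with that \<phi>[of x] have "(\<phi> has_vector_derivative \<phi>' x) (at x within {a..t})"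
      by (auto simp: has_real_derivative_iff_has_vector_derivative[symmetric]
          intro: has_field_derivative_at_within)
    from has_vector_derivative_scaleR[OF _ has_vector_derivative_const, of \<phi> "\<phi>' x" x "{a..t}" u]
      this
    show "((\<lambda>x. \<phi> x *\<^sub>R u) has_vector_derivative \<phi>' x *\<^sub>R u) (at x within {a..t})"
      by (simp add: has_real_derivative_iff_has_vector_derivative)
  qed (use that in \<open>auto intro!: continuous_intros continuous_on_subset[OF \<phi>']\<close>)
  show ?thesis
    unfolding strat_process_def
  proof (rule CollectI, intro conjI exI[of _ "\<lambda>s _. \<phi>' s *\<^sub>R u"] exI[of _ ?\<sigma>] ballI)
    fix t assume "t \<in> {a..b}"
    then show "\<exists>I. has_ito_integral M B a t (\<lambda>s \<omega>. ?\<sigma> s (c + \<phi> s *\<^sub>R u)) I \<and>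
       (AE \<omega> in M. c + \<phi> t *\<^sub>R u = c + \<phi> a *\<^sub>R u
          + (LINT s:{a..t}|lborel. \<phi>' s *\<^sub>R u + strat_correction ?\<sigma> s (c + \<phi> s *\<^sub>R u)) + I \<omega>)"
      by (intro exI[of _ "\<lambda>_. 0"]) (simp add: ito int)
  next
    show "AE \<omega> in M. set_integrable lborel {a..b}
        (\<lambda>s. \<phi>' s *\<^sub>R u + strat_correction ?\<sigma> s (c + \<phi> s *\<^sub>R u))"
      unfolding corr
      by (intro AE_I2 borel_integrable_atLeastAtMost' continuous_intros \<phi>')
  qed (use \<sigma> cont in auto)
qed

section \<open>Integration against Brownian motion and its increments\<close>

lemma brownian_motionD:
  fixes B :: "real \<Rightarrow> 'w \<Rightarrow> real^'n"
  assumes "brownian_motion M F B"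
  shows "prob_space M" "\<And>t. 0 \<le> t \<Longrightarrow> B t \<in> borel_measurable M"
    "0 \<le> a \<Longrightarrow> AE \<omega> in M. continuous_on {a..b} (\<lambda>t. B t \<omega>)"
proof -
  show "prob_space M" using assms by (simp add: brownian_motion_def)
  fix t :: real assume "0 \<le> t"
  interpret filtration "space M" F using assms by (simp add: brownian_motion_def)
  have "B t \<in> borel_measurable (F t)" "sets (F t) \<subseteq> sets M"
    using assms \<open>0 \<le> t\<close> by (simp_all add: brownian_motion_def)
  then show "B t \<in> borel_measurable M"
    by (auto simp: measurable_def space_F)
next
  assume "0 \<le> a"
  have "AE \<omega> in M. continuous_on {0..} (\<lambda>t. B t \<omega>)"
    using assms by (simp add: brownian_motion_def)
  then show "AE \<omega> in M. continuous_on {a..b} (\<lambda>t. B t \<omega>)"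
    by eventually_elim (rule continuous_on_subset, use \<open>0 \<le> a\<close> in auto)
qed

text \<open>Summation by parts turns the sums into Riemann sums of \<open>- \<phi>' \<cdot> B dt\<close>, so that no
  stochastic integration theory is needed.\<close>

lemma wiener_integral:
  fixes B :: "real \<Rightarrow> 'w \<Rightarrow> real^'n"
  assumes B: "brownian_motion M F B" and "0 \<le> a" "a < b"
    and \<phi>: "\<And>t. t \<in> {a..b} \<Longrightarrow> (\<phi> has_real_derivative \<phi>' t) (at t)"
    and \<phi>': "continuous_on {a..b} \<phi>'" and ends: "\<phi> a = 0" "\<phi> b = 0"
  obtains K where "has_strat_integral M a b (\<lambda>t \<omega>. \<phi> t *\<^sub>R g) B K"
    "AE \<omega> in M. K \<omega> = - integral {a..b} (\<lambda>t. \<phi>' t * (g \<bullet> B t \<omega>))"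
proof -
  interpret prob_space M using B by (rule brownian_motionD)
  define S where "S N \<tau> \<omega> = (\<Sum>i<N. ((\<phi> (\<tau> i) *\<^sub>R g + \<phi> (\<tau> (Suc i)) *\<^sub>R g) /\<^sub>R 2)
      \<bullet> (B (\<tau> (Suc i)) \<omega> - B (\<tau> i) \<omega>))" for N \<tau> \<omega>
  let ?J = "\<lambda>\<omega>. - integral {a..b} (\<lambda>t. \<phi>' t * (g \<bullet> B t \<omega>))"
  let ?P = "\<lambda>\<delta> N \<tau>. interval_partition a b N \<tau> \<and> (\<forall>i<N. \<tau> (Suc i) - \<tau> i < \<delta>)"
  have S: "S N \<tau> \<in> borel_measurable M" if "interval_partition a b N \<tau>" for N \<tau>
  proof -
    have "B (\<tau> i) \<in> borel_measurable M" if "i \<le> N" for i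
      using interval_partition_in_Icc[OF \<open>interval_partition a b N \<tau>\<close> that] \<open>0 \<le> a\<close>
      by (intro brownian_motionD(2)[OF B]) auto
    then show ?thesis
      unfolding S_def by (intro borel_measurable_sum borel_measurable_inner borel_measurable_diff) auto
  qed
  have S_eq: "S N \<tau> \<omega> = (\<Sum>i<N. (\<phi> (\<tau> i) + \<phi> (\<tau> (Suc i))) / 2 *
      (g \<bullet> B (\<tau> (Suc i)) \<omega> - g \<bullet> B (\<tau> i) \<omega>))" for N \<tau> \<omega>
    unfolding S_def by (intro sum.cong refl)
      (simp add: inner_diff_right right_diff_distrib flip: scaleR_left_distrib)
  have "AE \<omega> in M. continuous_on {a..b} (\<lambda>t. B t \<omega>)"
    using B \<open>0 \<le> a\<close> by (rule brownian_motionD(3))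
  then have lim: "AE \<omega> in M. \<forall>e>0. \<exists>\<delta>>0. \<forall>N \<tau>. ?P \<delta> N \<tau> \<longrightarrow> norm (S N \<tau> \<omega> - ?J \<omega>) < e"
  proof eventually_elim
    case (elim \<omega>)
    then have "continuous_on {a..b} (\<lambda>t. g \<bullet> B t \<omega>)"
      by (intro continuous_intros)
    then show ?case
      unfolding S_eq real_norm_def
      by (intro allI impI trapezoid_sums_converge[OF \<open>a < b\<close> \<phi> \<phi>' _ ends])
  qed
  have "\<exists>N \<tau>. ?P (1 / real (Suc n)) N \<tau>" for n
    by (rule interval_partition_fine[OF \<open>a < b\<close>, of "1 / real (Suc n)"]) auto
  then obtain N \<tau> where P: "\<And>n. ?P (1 / real (Suc n)) (N n) (\<tau> n)"
    by metis
  \<comment> \<open>The integral \<open>?J\<close> is only controlled on the paths that are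
    continuous, and measurability is demanded everywhere. A pointwise limit of measurable sums
    provides a measurable version.\<close>
  define K where "K \<omega> = lim (\<lambda>n. S (N n) (\<tau> n) \<omega>)" for \<omega>
  have [measurable]: "K \<in> borel_measurable M"
    unfolding K_def using S P by (intro borel_measurable_lim_metric) auto
  have K: "AE \<omega> in M. K \<omega> = ?J \<omega>"
    using lim
  proof eventually_elim
    case (elim \<omega>)
    have "(\<lambda>n. S (N n) (\<tau> n) \<omega>) \<longlonglongrightarrow> ?J \<omega>"
    proof (rule LIMSEQ_I)
      fix e :: real assume "0 < e"
      with elim obtain \<delta> where \<delta>: "\<delta> > 0"
        "\<And>N \<tau>. ?P \<delta> N \<tau> \<Longrightarrow> norm (S N \<tau> \<omega> - ?J \<omega>) < e" by meson
      obtain m where m: "1 / real (Suc m) < \<delta>"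
        using \<open>\<delta> > 0\<close> nat_approx_posE by blast
      show "\<exists>m. \<forall>n\<ge>m. norm (S (N n) (\<tau> n) \<omega> - ?J \<omega>) < e"
      proof (intro exI allI impI \<delta>(2))
        fix n assume "m \<le> n"
        then have "1 / real (Suc n) \<le> 1 / real (Suc m)"
          by (simp add: frac_le)
        with m P[of n] show "?P \<delta> (N n) (\<tau> n)" by fastforce
      qed
    qed
    then show ?case unfolding K_def by (rule limI)
  qed
  have "tendsto_in_prob_mesh M a b S K"
  proof (rule tendsto_in_prob_mesh_AE[OF _ S])
    show "AE \<omega> in M. \<forall>e>0. \<exists>\<delta>>0. \<forall>N \<tau>. ?P \<delta> N \<tau> \<longrightarrow> norm (S N \<tau> \<omega> - K \<omega>) < e"
      using lim K by eventually_elim simp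
  qed auto
  then have "has_strat_integral M a b (\<lambda>t \<omega>. \<phi> t *\<^sub>R g) B K"
    unfolding has_strat_integral_def S_def .
  from this K show thesis by (rule that)
qed

text \<open>Multiplying the identity by the component \<open>X i\<close> and taking expectations
  gives \<open>g $ i * (b - a) = 0\<close>: by independence the mixed moments vanish, and the
  right-hand side has mean \<open>c\<close> times 0. Then \<open>c = 0\<close> follows.\<close>

lemma brownian_increment_nondegenerate:
  fixes B :: "real \<Rightarrow> 'w \<Rightarrow> real^'n"
  assumes B: "brownian_motion M F B" and "0 \<le> a" "a < b"
    and AE: "AE \<omega> in M. g \<bullet> (B b \<omega> - B a \<omega>) = c"
  shows "g = 0 \<and> c = 0"
proof -
  interpret prob_space M using B by (rule brownian_motionD)
  define X where "X j \<omega> = B b \<omega> $ j - B a \<omega> $ j" for j \<omega>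
  have D: "distributed M lborel (X j) (normal_density 0 (sqrt (b - a)))" for j
    using B \<open>0 \<le> a\<close> \<open>a < b\<close> by (auto simp: brownian_motion_def X_def[abs_def])
  have indep: "indep_vars (\<lambda>_. borel) X UNIV"
    using B \<open>0 \<le> a\<close> \<open>a < b\<close> by (auto simp: brownian_motion_def X_def[abs_def])
  have sqrt: "0 < sqrt (b - a)" using \<open>a < b\<close> by simp
  have mean: "expectation (X j) = 0" for j
    by (rule normal_distributed_expectation[OF sqrt D])
  have sq: "expectation (\<lambda>\<omega>. X j \<omega> * X j \<omega>) = b - a" for j
    using normal_distributed_variance[OF sqrt D, of j] mean[of j] \<open>a < b\<close>
    by (simp add: power2_eq_square)
  have int: "integrable M (X j)" for j
    using distributed_integrable[OF D, of "\<lambda>x. x" j] integrable_normal_moment_nz_1[OF sqrt, of 0]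
    by simp
  have int_sq: "integrable M (\<lambda>\<omega>. X j \<omega> * X j \<omega>)" for j
    using distributed_integrable[OF D, of "\<lambda>x. x * x" j] integrable_normal_moment[OF sqrt, of 0 2]
    by (simp add: power2_eq_square)
  have cov: "integrable M (\<lambda>\<omega>. X i \<omega> * X j \<omega>)" "expectation (\<lambda>\<omega>. X i \<omega> * X j \<omega>) = 0"
    if "i \<noteq> j" for i j
    using indep_vars_integrable[OF _ indep_vars_subset[OF indep], of "{i, j}"]
      indep_vars_lebesgue_integral[OF _ indep_vars_subset[OF indep], of "{i, j}"] that int mean
    by auto
  have int2: "integrable M (\<lambda>\<omega>. X i \<omega> * X j \<omega>)" for i j
    using cov(1) int_sq by (cases "i = j") auto
  have sum: "AE \<omega> in M. (\<Sum>j\<in>UNIV. g $ j * X j \<omega>) = c"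
    using AE by (simp add: inner_vec_def X_def)
  have g: "g $ i = 0" for i
  proof -
    have "(\<Sum>j\<in>UNIV. g $ j * expectation (\<lambda>\<omega>. X i \<omega> * X j \<omega>))
        = expectation (\<lambda>\<omega>. \<Sum>j\<in>UNIV. g $ j * (X i \<omega> * X j \<omega>))"
      by (subst Bochner_Integration.integral_sum) (auto simp: int2)
    also have "\<dots> = expectation (\<lambda>\<omega>. c * X i \<omega>)"
    proof (rule integral_cong_AE)
      show "AE \<omega> in M. (\<Sum>j\<in>UNIV. g $ j * (X i \<omega> * X j \<omega>)) = c * X i \<omega>"
        using sum by eventually_elim
          (auto simp: sum_distrib_left sum_distrib_right mult_ac)
    qed (use int2 int in \<open>auto intro!: borel_measurable_sum borel_measurable_times\<close>)
    also have "\<dots> = 0" by (simp add: mean)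
    also have "(\<Sum>j\<in>UNIV. g $ j * expectation (\<lambda>\<omega>. X i \<omega> * X j \<omega>))
        = (\<Sum>j\<in>UNIV. if j = i then g $ i * (b - a) else 0)"
      by (intro sum.cong) (auto simp: sq cov(2))
    finally show ?thesis using \<open>a < b\<close> by simp
  qed
  then have "g = 0" by (simp add: vec_eq_iff)
  with AE have "AE \<omega> in M. 0 = c" by simp
  then show ?thesis using \<open>g = 0\<close> by simp
qed


section \<open>Self-adjointness implies symmetry\<close>

text \<open>Against a constant all increments are zero; exchanging the two slots gives the second
  claim. Thus the \<open>dX\<close> terms drop out of both pairings in the test below.\<close>

lemma has_strat_integral_const:
  assumes "\<And>\<omega>. \<omega> \<in> space M \<Longrightarrow> W a \<omega> = 0 \<and> W b \<omega> = 0"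
  shows "has_strat_integral M a b (\<lambda>t \<omega>. symp_J (W t \<omega>)) (\<lambda>_ _. y) (\<lambda>_. 0)"
    and "has_strat_integral M a b (\<lambda>_ _. symp_J y) W (\<lambda>_. 0)"
proof -
  show "has_strat_integral M a b (\<lambda>t \<omega>. symp_J (W t \<omega>)) (\<lambda>_ _. y) (\<lambda>_. 0)"
    by (simp add: has_strat_integral_def tendsto_in_prob_mesh_zero)
  then show "has_strat_integral M a b (\<lambda>_ _. symp_J y) W (\<lambda>_. 0)"
    using has_strat_integral_symp_commute[where Y = "\<lambda>_ _. y", of M W a b] assms by simp
qed

context
  fixes M :: "'w measure" and F :: "real \<Rightarrow> 'w measure" and B :: "real \<Rightarrow> 'w \<Rightarrow> real^'n"
    and a b :: real and X :: "('d::finite, 'n::finite) stoch_field"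
  assumes B: "brownian_motion M F B" and ab: "0 \<le> a" "a < b"
begin

text \<open>Up to sign, \<open>drift_form\<close> and \<open>noise_form\<close> are the
  \<open>dt\<close> and \<open>\<circ> dB\<close> coefficients of the pairing of the derivative at
  the constant base point \<open>z\<close> with a test vector. Their antisymmetric parts in
  \<open>y\<close> and \<open>w\<close> have to be shown to vanish.\<close>

definition drift_form :: "'d phase \<Rightarrow> 'd phase \<Rightarrow> 'd phase \<Rightarrow> real" where
  "drift_form z y w = symp_J y \<bullet> (phase_deriv (XQD X) z w, phase_deriv (XPD X) z w)"

definition noise_form :: "'d phase \<Rightarrow> 'd phase \<Rightarrow> 'd phase \<Rightarrow> real^'n" where
  "noise_form z y w = (\<chi> j. symp_J y \<bullet>
     (column j (phase_deriv (XQS X) z w), column j (phase_deriv (XPS X) z w)))"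

lemma drift_form_scaleR:
  "drift_form z (c *\<^sub>R y) w = c * drift_form z y w" "drift_form z y (c *\<^sub>R w) = c * drift_form z y w"
  by (simp_all add: drift_form_def linear_scale[OF linear_phase_deriv] linear_scale[OF linear_symp_J]
      flip: scaleR_Pair del: inner_Pair)

lemma noise_form_scaleR:
  "noise_form z (c *\<^sub>R y) w = c *\<^sub>R noise_form z y w"
  "noise_form z y (c *\<^sub>R w) = c *\<^sub>R noise_form z y w"
  by (simp_all add: noise_form_def vec_eq_iff linear_scale[OF linear_phase_deriv]
      linear_scale[OF linear_symp_J] linear_scale[OF bounded_linear.linear[OF bounded_linear_column]]
      flip: scaleR_Pair del: inner_Pair)

lemma has_J_pairing_D_field_op:
  "has_J_pairing M B a b (D_field_op X (\<lambda>_ _. z) W) Y I \<longleftrightarrow>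
     (\<exists>I\<^sub>X I\<^sub>B. has_strat_integral M a b (\<lambda>t \<omega>. symp_J (Y t \<omega>)) W I\<^sub>X \<and>
        has_strat_integral M a b (\<lambda>t \<omega>. - noise_form z (Y t \<omega>) (W t \<omega>)) B I\<^sub>B \<and>
        (AE \<omega> in M. set_integrable lborel {a..b} (\<lambda>t. - drift_form z (Y t \<omega>) (W t \<omega>))) \<and>
        (AE \<omega> in M. I \<omega> = I\<^sub>X \<omega> + (LINT t:{a..b}|lborel. - drift_form z (Y t \<omega>) (W t \<omega>)) + I\<^sub>B \<omega>))"
proof -
  have "- noise_form z y w = (\<chi> j. symp_J y \<bullet>
     - (column j (phase_deriv (XQS X) z w), column j (phase_deriv (XPS X) z w)))" for y w
    by (simp add: noise_form_def vec_eq_iff inner_minus_right del: inner_Pair uminus_Pair)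
  moreover have "- drift_form z y w = symp_J y \<bullet> - (phase_deriv (XQD X) z w, phase_deriv (XPD X) z w)"
    for y w
    by (simp add: drift_form_def inner_minus_right del: inner_Pair uminus_Pair)
  ultimately show ?thesis
    by (simp add: has_J_pairing_def has_strat_pairing_def D_field_op_def field_sdiff_def
        del: inner_Pair uminus_Pair)
qed

text \<open>Both pairings are computed for \<open>?W\<close>, which vanishes at the endpoints, and
  the constant \<open>?Y\<close>. The two noise terms are explicit by
  \<open>wiener_integral\<close>.\<close>

lemma J_self_adjoint_test:
  assumes adj: "J_self_adjoint M F B a b (D_field_op X (\<lambda>_ _. z))"
    and \<phi>: "\<And>t. (\<phi> has_real_derivative \<phi>' t) (at t)"
    and \<phi>': "continuous_on {a..b} \<phi>'" and ends: "\<phi> a = 0" "\<phi> b = 0"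
  shows "AE \<omega> in M. (drift_form z y w - drift_form z w y) * integral {a..b} \<phi>
    = integral {a..b} (\<lambda>t. \<phi>' t * ((noise_form z y w - noise_form z w y) \<bullet> B t \<omega>))"
proof -
  interpret prob_space M using B by (rule brownian_motionD)
  let ?W = "\<lambda>t (\<omega>::'w). \<phi> t *\<^sub>R w" and ?Y = "\<lambda>(t::real) (\<omega>::'w). y"
  have cont: "continuous_on {a..b} \<phi>"
    by (intro DERIV_atLeastAtMost_imp_continuous_on) (use \<phi> in auto)
  have int: "set_integrable lborel {a..b} (\<lambda>t. - (\<phi> t * c))"
    "(LINT t:{a..b}|lborel. - (\<phi> t * c)) = - (integral {a..b} \<phi> * c)" for c
  proof -
    show *: "set_integrable lborel {a..b} (\<lambda>t. - (\<phi> t * c))"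
      by (intro borel_integrable_atLeastAtMost' continuous_intros cont)
    show "(LINT t:{a..b}|lborel. - (\<phi> t * c)) = - (integral {a..b} \<phi> * c)"
      using set_borel_integral_eq_integral(2)[OF *] by simp
  qed
  have W0: "?W a \<omega> = 0 \<and> ?W b \<omega> = 0" for \<omega> using ends by simp
  have W: "(\<lambda>t \<omega>. \<phi> t *\<^sub>R u) \<in> strat_process_0 M F B a b" for u :: "real^'d"
    using deterministic_strat_process[OF \<phi> \<phi>', of 0 u] ends
    by (simp add: strat_process_0_def)
  have Y: "(\<lambda>_ _. u) \<in> strat_process M F B a b" for u :: "real^'d"
    using deterministic_strat_process[of a b "\<lambda>_. 0" "\<lambda>_. 0" u 0] by simp
  have pW: "pair_process (\<lambda>t (\<omega>::'w). \<phi> t *\<^sub>R fst w) (\<lambda>t \<omega>. \<phi> t *\<^sub>R snd w) = ?W"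
    by (intro ext) (simp add: pair_process_def prod_eq_iff)
  have pY: "pair_process (\<lambda>_ _. fst y) (\<lambda>_ _. snd y) = ?Y"
    by (auto simp: pair_process_def fun_eq_iff)
  have swap: "has_J_pairing M B a b (D_field_op X (\<lambda>_ _. z) ?W) ?Y I \<longleftrightarrow>
      has_J_pairing M B a b (D_field_op X (\<lambda>_ _. z) ?Y) ?W I" for I
    using adj W[of "fst w"] W[of "snd w"] Y[of "fst y"] Y[of "snd y"]
    unfolding J_self_adjoint_def is_J_adjoint_def pW[symmetric] pY[symmetric] by blast
  obtain K1 where K1: "has_strat_integral M a b (\<lambda>t \<omega>. \<phi> t *\<^sub>R - noise_form z y w) B K1"
    "AE \<omega> in M. K1 \<omega> = - integral {a..b} (\<lambda>t. \<phi>' t * (- noise_form z y w \<bullet> B t \<omega>))"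
    using wiener_integral[OF B ab \<phi> \<phi>' ends] .
  obtain K2 where K2: "has_strat_integral M a b (\<lambda>t \<omega>. \<phi> t *\<^sub>R - noise_form z w y) B K2"
    "AE \<omega> in M. K2 \<omega> = - integral {a..b} (\<lambda>t. \<phi>' t * (- noise_form z w y \<bullet> B t \<omega>))"
    using wiener_integral[OF B ab \<phi> \<phi>' ends] .
  \<comment> \<open>Self-adjointness is an equivalence for each version, so one side must first be
    shown to exist; \<open>?I\<close> is an explicit version of it.\<close>
  let ?I = "\<lambda>\<omega>. - (integral {a..b} \<phi> * drift_form z y w) + K1 \<omega>"
  have "has_J_pairing M B a b (D_field_op X (\<lambda>_ _. z) ?W) ?Y ?I"
    unfolding has_J_pairing_D_field_op
    by (rule exI[of _ "\<lambda>_. 0"], rule exI[of _ K1])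
       (use K1(1) int has_strat_integral_const(2)[of M ?W a b y] W0 in
         \<open>simp add: drift_form_scaleR noise_form_scaleR\<close>)
  \<comment> \<open>By self-adjointness \<open>?I\<close> is also a version of the exchanged
    pairing. The integrals obtained here are unspecified, and are identified almost surely by
    uniqueness of limits in probability.\<close>
  then obtain I\<^sub>X I\<^sub>B where
      IX: "has_strat_integral M a b (\<lambda>t \<omega>. symp_J (?W t \<omega>)) ?Y I\<^sub>X" and
      IB: "has_strat_integral M a b (\<lambda>t \<omega>. \<phi> t *\<^sub>R - noise_form z w y) B I\<^sub>B" and
      I: "AE \<omega> in M. ?I \<omega> = I\<^sub>X \<omega> - integral {a..b} \<phi> * drift_form z w y + I\<^sub>B \<omega>"
    unfolding swap has_J_pairing_D_field_op
    by (auto simp: drift_form_scaleR noise_form_scaleR int)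
  have "AE \<omega> in M. I\<^sub>X \<omega> = 0"
    using tendsto_in_prob_mesh_unique[OF IX[unfolded has_strat_integral_def]
        has_strat_integral_const(1)[of M ?W a b y, unfolded has_strat_integral_def]] W0 ab
    by simp
  moreover have "AE \<omega> in M. I\<^sub>B \<omega> = K2 \<omega>"
    using tendsto_in_prob_mesh_unique[OF IB[unfolded has_strat_integral_def]
        K2(1)[unfolded has_strat_integral_def] ab(2)] .
  moreover have "AE \<omega> in M. continuous_on {a..b} (\<lambda>t. B t \<omega>)"
    using B ab(1) by (rule brownian_motionD(3))
  ultimately show ?thesis
    using I K1(2) K2(2)
  proof eventually_elim
    case (elim \<omega>)
    let ?J = "\<lambda>g. integral {a..b} (\<lambda>t. \<phi>' t * (g \<bullet> B t \<omega>))"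
    have "?J (noise_form z y w - noise_form z w y) = ?J (noise_form z y w) - ?J (noise_form z w y)"
      unfolding inner_diff_left right_diff_distrib
      by (intro integral_diff integrable_continuous_interval continuous_intros \<phi>' elim)
    then show ?case
      using elim by (simp add: algebra_simps)
  qed
qed

text \<open>Along the functions \<open>bump\<close>, the left side of the test identity tends to
  \<open>?c * (b - a)\<close> and the right side to minus the increment of
  \<open>?g \<bullet> B\<close>. That increment is then almost surely constant, which forces both
  antisymmetric parts to be 0.\<close>

lemma J_self_adjoint_imp_forms_symmetric:
  assumes "J_self_adjoint M F B a b (D_field_op X (\<lambda>_ _. z))"
  shows "drift_form z y w = drift_form z w y \<and> noise_form z y w = noise_form z w y"
proof -
  let ?c = "drift_form z y w - drift_form z w y"
  let ?g = "noise_form z y w - noise_form z w y"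
  \<comment> \<open>The test functions form a sequence, so a single null set serves for all of them
    and the limit can be taken path by path.\<close>
  have "AE \<omega> in M. \<forall>n. ?c * integral {a..b} (bump a b n)
      = integral {a..b} (\<lambda>t. bump' a b n t * (?g \<bullet> B t \<omega>))"
    unfolding AE_all_countable
    using J_self_adjoint_test[OF assms bump_has_derivative continuous_on_bump' bump_endpoints] ab
    by blast
  moreover have "AE \<omega> in M. continuous_on {a..b} (\<lambda>t. B t \<omega>)"
    using B ab(1) by (rule brownian_motionD(3))
  ultimately have "AE \<omega> in M. ?g \<bullet> (B b \<omega> - B a \<omega>) = - ?c * (b - a)"
  proof eventually_elim
    case (elim \<omega>)
    have "(\<lambda>n. ?c * integral {a..b} (bump a b n)) \<longlonglongrightarrow> ?g \<bullet> B a \<omega> - ?g \<bullet> B b \<omega>"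
      unfolding elim(1)[rule_format]
      by (intro integral_bump'_tendsto ab continuous_intros elim)
    moreover have "(\<lambda>n. ?c * integral {a..b} (bump a b n)) \<longlonglongrightarrow> ?c * (b - a)"
      by (intro tendsto_intros integral_bump_tendsto ab)
    ultimately have "?g \<bullet> B a \<omega> - ?g \<bullet> B b \<omega> = ?c * (b - a)"
      by (rule LIMSEQ_unique)
    then show ?case unfolding inner_diff_right mult_minus_left by linarith
  qed
  from brownian_increment_nondegenerate[OF B ab this] ab show ?thesis by simp
qed

text \<open>Constant processes are admissible base points, so the derivative of the field can be
  tested at every point \<open>z\<close> of phase space.\<close>

lemma J_self_adjoint_imp_symmetric_field:
  assumes "C1_field X"
    and "\<forall>R \<in> strat_process M F B a b. J_self_adjoint M F B a b (D_field_op X R)"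
  shows "symmetric_field X"
proof -
  have "(\<lambda>_ _. z) \<in> strat_process M F B a b" for z :: "'d phase"
    using deterministic_strat_process[of a b "\<lambda>_. 0" "\<lambda>_. 0" z 0] by simp
  with assms(2) have *: "drift_form z y w = drift_form z w y \<and> noise_form z y w = noise_form z w y"
    for z y w
    using J_self_adjoint_imp_forms_symmetric by blast
  then show ?thesis
    unfolding symmetric_field_def symp_symmetric_def phase_deriv_column[OF assms(1), symmetric]
      drift_form_def noise_form_def vec_eq_iff vec_lambda_beta by blast
qed

end

theorem theorem21:
  fixes M :: "'w measure"
    and F :: "real \<Rightarrow> 'w measure"
    and B :: "real \<Rightarrow> 'w \<Rightarrow> real^'n"
    and a b :: real
    and X :: "('d::finite, 'n::finite) stoch_field"
  assumes "brownian_motion M F B"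
    and "0 \<le> a" and "a < b"
    and "C1_field X"
  shows "(stoch_hamiltonian X \<longleftrightarrow>
            (\<forall>R \<in> strat_process M F B a b. J_self_adjoint M F B a b (D_field_op X R))) \<and>
         (stoch_hamiltonian X \<longrightarrow> is_hamiltonian X (ham_D X) (ham_S X))"
  \<comment> \<open>The witnesses for \<open>stoch_hamiltonian X\<close> are \<open>ham_D X\<close>
    and \<open>ham_S X\<close>. Conversely, any Hamiltonian whatsoever gives a symmetric field, for
    which these two are again a Hamiltonian.\<close>
  using J_self_adjoint_imp_symmetric_field[OF assms(1-4)]
    symmetric_field_imp_J_self_adjoint[OF assms(4)]
    stoch_hamiltonian_imp_symmetric_field[OF assms(4)]
    symmetric_field_imp_is_hamiltonian[OF assms(4)]
  unfolding stoch_hamiltonian_def by blast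

end
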